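(* Let $r\in(0,1]$, $p\in[0,1)\cap\mathbb{Q}$ and $\gamma\in\omega+1$. Then: (i) a base for the admissible rules of $\mathbf{RG}_r$ is given by the rules $\mathbf{c}_q\vee z\rhd z$ for all $q\in[0,r)\cap\mathbb{Q}$; (ii) a base for the admissible rules of $\mathbf{RG}_p^\gamma$ is given by the single rule $\mathbf{c}_p\vee z\rhd z$.
   Context: A BL-algebra is an algebra $\langle A;\wedge,\vee,\cdot,\to,0,1\rangle$ such that $\langle A;\wedge,\vee,0,1\rangle$ is a bounded lattice, $\langle A;\cdot,1\rangle$ is a commutative monoid, $a\cdot b\le c\iff a\le b\to c$, $(a\to c)\vee(c\to a)=1$ and $a\wedge c=a\cdot(a\to c)$. The standard Gödel algebra $[0,1]_G$ is the BL-algebra on the real $[0,1]$ with usual order, $a\cdot c=\min\{a,c\}$ and $a\to c=1$ if $a\le c$, $c$ otherwise; Gödel algebras are the members of the variety it generates. With new constants $\{\mathbf{c}_q:q\in[0,1]\cap\mathbb{Q}\}$, a rational Gödel algebra is an algebra in the BL language expanded by these constants whose BL-reduct is a Gödel algebra and satisfying $\mathbf{c}_p\cdot\mathbf{c}_q\approx\mathbf{c}_{p\cdot q}$, $\mathbf{c}_p\to\mathbf{c}_q\approx\mathbf{c}_{p\to q}$ (computed in $[0,1]_G$), $\mathbf{c}_0\approx0$, $\mathbf{c}_1\approx1$; $\mathsf{RGA}$ is their variety. Rational Gödel logic $\mathbf{RG}$: $\Gamma\vdash\varphi$ iff for some finite $\Delta\subseteq\Gamma$, $\{\delta\approx1:\delta\in\Delta\}\models_{\mathsf{RGA}}\varphi\approx1$.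 For a logic $\vdash$ and formulas $\Sigma$, $\vdash+\Sigma$ is the extension of $\vdash$ obtained by adding all substitution instances of $\Sigma$ as axioms. $\mathbf{RG}_r:=\mathbf{RG}+\{\mathbf{c}_q:q\in[r,1]\cap\mathbb{Q}\}$; $\mathbf{RG}_p^\omega:=\mathbf{RG}+\{\mathbf{c}_q:q\in(p,1]\cap\mathbb{Q}\}$; for $n\in\omega$, $\mathbf{RG}_p^n:=\mathbf{RG}_p^\omega+\bigvee_{0\le i<j\le n+2}(\mathbf{c}_p\vee x_i)\leftrightarrow(\mathbf{c}_p\vee x_j)$, where $x\leftrightarrow y:=(x\to y)\wedge(y\to x)$. A rule $\Gamma\rhd\varphi$ (finite $\Gamma$) is admissible in $\vdash$ if for every substitution $\sigma$, $\emptyset\vdash\sigma(\gamma)$ for all $\gamma\in\Gamma$ implies $\emptyset\vdash\sigma(\varphi)$. The structural completion of $\vdash$ is the unique extension whose derivable rules are exactly the rules admissible in $\vdash$; a base for the admissible rules of $\vdash$ is a set of rules whose addition to $\vdash$ axiomatizes its structural completion. *)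

theory Defs
  imports Complex_Main "HOL-Library.Countable_Set" "HOL-Library.Extended_Nat" "HOL-Algebra.Group"
begin

section \<open>BL-algebras and Goedel algebras\<close>

text \<open>The monoid product is \<open>mult\<close> and its unit \<open>one\<close> is also the top of the lattice.\<close>

record 'a bl = "'a monoid" +
  bmeet :: "'a \<Rightarrow> 'a \<Rightarrow> 'a"
  bjoin :: "'a \<Rightarrow> 'a \<Rightarrow> 'a"
  bimp :: "'a \<Rightarrow> 'a \<Rightarrow> 'a"
  bzero :: 'a

definition bleq :: "('a, 'm) bl_scheme \<Rightarrow> 'a \<Rightarrow> 'a \<Rightarrow> bool"
  where "bleq A a b \<longleftrightarrow> bmeet A a b = a"

locale bl_algebra = comm_monoid A for A :: "('a, 'm) bl_scheme" (structure) +
  assumes meet_closed: "\<lbrakk>a \<in> carrier A; b \<in> carrier A\<rbrakk> \<Longrightarrow> bmeet A a b \<in> carrier A"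
    and join_closed: "\<lbrakk>a \<in> carrier A; b \<in> carrier A\<rbrakk> \<Longrightarrow> bjoin A a b \<in> carrier A"
    and imp_closed: "\<lbrakk>a \<in> carrier A; b \<in> carrier A\<rbrakk> \<Longrightarrow> bimp A a b \<in> carrier A"
    and zero_closed: "bzero A \<in> carrier A"
    and meet_comm: "\<lbrakk>a \<in> carrier A; b \<in> carrier A\<rbrakk> \<Longrightarrow> bmeet A a b = bmeet A b a"
    and join_comm: "\<lbrakk>a \<in> carrier A; b \<in> carrier A\<rbrakk> \<Longrightarrow> bjoin A a b = bjoin A b a"
    and meet_assoc: "\<lbrakk>a \<in> carrier A; b \<in> carrier A; c \<in> carrier A\<rbrakk>
          \<Longrightarrow> bmeet A (bmeet A a b) c = bmeet A a (bmeet A b c)"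
    and join_assoc: "\<lbrakk>a \<in> carrier A; b \<in> carrier A; c \<in> carrier A\<rbrakk>
          \<Longrightarrow> bjoin A (bjoin A a b) c = bjoin A a (bjoin A b c)"
    and meet_absorb: "\<lbrakk>a \<in> carrier A; b \<in> carrier A\<rbrakk> \<Longrightarrow> bmeet A a (bjoin A a b) = a"
    and join_absorb: "\<lbrakk>a \<in> carrier A; b \<in> carrier A\<rbrakk> \<Longrightarrow> bjoin A a (bmeet A a b) = a"
    and zero_least: "a \<in> carrier A \<Longrightarrow> bleq A (bzero A) a"
    and one_greatest: "a \<in> carrier A \<Longrightarrow> bleq A a \<one>"
    and residuation: "\<lbrakk>a \<in> carrier A; b \<in> carrier A; c \<in> carrier A\<rbrakk>
          \<Longrightarrow> bleq A (a \<otimes> b) c \<longleftrightarrow> bleq A a (bimp A b c)"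
    and prelinearity: "\<lbrakk>a \<in> carrier A; c \<in> carrier A\<rbrakk>
          \<Longrightarrow> bjoin A (bimp A a c) (bimp A c a) = \<one>"
    and divisibility: "\<lbrakk>a \<in> carrier A; c \<in> carrier A\<rbrakk> \<Longrightarrow> bmeet A a c = a \<otimes> bimp A a c"

datatype bl_term =
    BVar nat
  | BMeet bl_term bl_term
  | BJoin bl_term bl_term
  | BMult bl_term bl_term
  | BImp bl_term bl_term
  | BZero
  | BOne

primrec bl_eval :: "('a, 'm) bl_scheme \<Rightarrow> (nat \<Rightarrow> 'a) \<Rightarrow> bl_term \<Rightarrow> 'a" where
  "bl_eval A v (BVar n) = v n"
| "bl_eval A v (BMeet s t) = bmeet A (bl_eval A v s) (bl_eval A v t)"
| "bl_eval A v (BJoin s t) = bjoin A (bl_eval A v s) (bl_eval A v t)"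
| "bl_eval A v (BMult s t) = mult A (bl_eval A v s) (bl_eval A v t)"
| "bl_eval A v (BImp s t) = bimp A (bl_eval A v s) (bl_eval A v t)"
| "bl_eval A v BZero = bzero A"
| "bl_eval A v BOne = one A"

definition bl_valid :: "('a, 'm) bl_scheme \<Rightarrow> bl_term \<Rightarrow> bl_term \<Rightarrow> bool"
  where "bl_valid A s t \<longleftrightarrow> (\<forall>v. range v \<subseteq> carrier A \<longrightarrow> bl_eval A v s = bl_eval A v t)"

definition std_goedel :: "real bl" where
  "std_goedel = \<lparr>carrier = {0..1}, mult = min, one = 1, bmeet = min, bjoin = max,
     bimp = (\<lambda>a c. if a \<le> c then 1 else c), bzero = 0\<rparr>"

text \<open>The variety generated by an algebra is the least equational class containing it, that is,
  the class of all models of the equations valid in that algebra.\<close>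

locale goedel_algebra = bl_algebra A for A :: "('a, 'm) bl_scheme" (structure) +
  assumes goedel_equations: "bl_valid std_goedel s t \<Longrightarrow> bl_valid A s t"


section \<open>Rational Goedel algebras\<close>

typedef qunit = "{0..1::real} \<inter> \<rat>"
  morphisms val Qunit
  by (rule exI[of _ 0]) auto

definition qmult :: "qunit \<Rightarrow> qunit \<Rightarrow> qunit"
  where "qmult p q = Qunit (mult std_goedel (val p) (val q))"

definition qimp :: "qunit \<Rightarrow> qunit \<Rightarrow> qunit"
  where "qimp p q = Qunit (bimp std_goedel (val p) (val q))"

lemma val_in: "0 \<le> val q" "val q \<le> 1" "val q \<in> \<rat>"
  using val[of q] by auto

lemma val_qmult: "val (qmult p q) = mult std_goedel (val p) (val q)"
  using val_in[of p] val_in[of q] by (simp add: qmult_def std_goedel_def Qunit_inverse min_def)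

lemma val_qimp: "val (qimp p q) = bimp std_goedel (val p) (val q)"
  using val_in[of p] val_in[of q] by (simp add: qimp_def std_goedel_def Qunit_inverse)

record 'a rbl = "'a bl" +
  bconst :: "qunit \<Rightarrow> 'a"

locale rational_goedel_algebra = goedel_algebra A for A :: "('a, 'm) rbl_scheme" (structure) +
  assumes const_closed: "bconst A q \<in> carrier A"
    and const_mult: "bconst A p \<otimes> bconst A q = bconst A (qmult p q)"
    and const_imp: "bimp A (bconst A p) (bconst A q) = bconst A (qimp p q)"
    and const_zero: "bconst A (Qunit 0) = bzero A"
    and const_one: "bconst A (Qunit 1) = \<one>"


section \<open>Formulas and rational Goedel logic\<close>

datatype fm =
    Var nat
  | Const qunit
  | And fm fm
  | Or fm fm
  | Mult fm fm
  | Imp fm fm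
  | Zero
  | One

primrec eval :: "('a, 'm) rbl_scheme \<Rightarrow> (nat \<Rightarrow> 'a) \<Rightarrow> fm \<Rightarrow> 'a" where
  "eval A v (Var n) = v n"
| "eval A v (Const q) = bconst A q"
| "eval A v (And \<phi> \<psi>) = bmeet A (eval A v \<phi>) (eval A v \<psi>)"
| "eval A v (Or \<phi> \<psi>) = bjoin A (eval A v \<phi>) (eval A v \<psi>)"
| "eval A v (Mult \<phi> \<psi>) = mult A (eval A v \<phi>) (eval A v \<psi>)"
| "eval A v (Imp \<phi> \<psi>) = bimp A (eval A v \<phi>) (eval A v \<psi>)"
| "eval A v Zero = bzero A"
| "eval A v One = one A"

primrec subst :: "(nat \<Rightarrow> fm) \<Rightarrow> fm \<Rightarrow> fm" where
  "subst \<sigma> (Var n) = \<sigma> n"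
| "subst \<sigma> (Const q) = Const q"
| "subst \<sigma> (And \<phi> \<psi>) = And (subst \<sigma> \<phi>) (subst \<sigma> \<psi>)"
| "subst \<sigma> (Or \<phi> \<psi>) = Or (subst \<sigma> \<phi>) (subst \<sigma> \<psi>)"
| "subst \<sigma> (Mult \<phi> \<psi>) = Mult (subst \<sigma> \<phi>) (subst \<sigma> \<psi>)"
| "subst \<sigma> (Imp \<phi> \<psi>) = Imp (subst \<sigma> \<phi>) (subst \<sigma> \<psi>)"
| "subst \<sigma> Zero = Zero"
| "subst \<sigma> One = One"

text \<open>HOL cannot quantify over algebras on all types inside a definition, so the algebras
  range over those whose universe is a set of reals.  Since the language is countable this
  is no restriction: lemma \<open>rga_entails_all\<close> below shows that the relation
  gives the entailment for rational Goedel algebras on an arbitrary type.\<close>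

definition rga_entails :: "fm set \<Rightarrow> fm \<Rightarrow> bool" where
  "rga_entails \<Delta> \<phi> \<longleftrightarrow>
     (\<forall>(A :: real rbl) v. rational_goedel_algebra A \<and> range v \<subseteq> carrier A \<and>
        (\<forall>\<delta>\<in>\<Delta>. eval A v \<delta> = one A) \<longrightarrow> eval A v \<phi> = one A)"

type_synonym conseq = "fm set \<Rightarrow> fm \<Rightarrow> bool"

definition RG :: conseq
  where "RG \<Gamma> \<phi> \<longleftrightarrow> (\<exists>\<Delta>. finite \<Delta> \<and> \<Delta> \<subseteq> \<Gamma> \<and> rga_entails \<Delta> \<phi>)"

definition add_axioms :: "conseq \<Rightarrow> fm set \<Rightarrow> conseq"
  where "add_axioms L \<Sigma> \<Gamma> \<phi> \<longleftrightarrow> L (\<Gamma> \<union> {subst \<sigma> s | \<sigma> s. s \<in> \<Sigma>}) \<phi>"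

text \<open>Meaningful for \<open>q \<in> [0,1] \<inter> \<rat>\<close> only.\<close>

definition cst :: "real \<Rightarrow> fm"
  where "cst q = Const (Qunit q)"

definition Iff :: "fm \<Rightarrow> fm \<Rightarrow> fm"
  where "Iff \<phi> \<psi> = And (Imp \<phi> \<psi>) (Imp \<psi> \<phi>)"

fun big_or :: "fm list \<Rightarrow> fm" where
  "big_or [] = Zero"
| "big_or [\<phi>] = \<phi>"
| "big_or (\<phi> # \<psi> # \<chi>s) = Or \<phi> (big_or (\<psi> # \<chi>s))"

definition RG_lower :: "real \<Rightarrow> conseq"
  where "RG_lower r = add_axioms RG {cst q | q. q \<in> {r..1} \<inter> \<rat>}"

definition RG_omega :: "real \<Rightarrow> conseq"
  where "RG_omega p = add_axioms RG {cst q | q. q \<in> {p<..1} \<inter> \<rat>}"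

definition bounded_axiom :: "real \<Rightarrow> nat \<Rightarrow> fm" where
  "bounded_axiom p n =
     big_or [Iff (Or (cst p) (Var i)) (Or (cst p) (Var j)). i \<leftarrow> [0..<n + 3], j \<leftarrow> [i + 1..<n + 3]]"

text \<open>The ordinal \<open>\<omega> + 1\<close> is represented by \<open>enat\<close>, with \<open>\<infinity>\<close> for \<open>\<omega>\<close>.\<close>

definition RG_upper :: "real \<Rightarrow> enat \<Rightarrow> conseq" where
  "RG_upper p \<gamma> =
     (case \<gamma> of enat n \<Rightarrow> add_axioms (RG_omega p) {bounded_axiom p n} | \<infinity> \<Rightarrow> RG_omega p)"


section \<open>Admissible rules and structural completion\<close>

definition is_logic :: "conseq \<Rightarrow> bool" where
  "is_logic L \<longleftrightarrow>
     (\<forall>\<Gamma> \<phi>. \<phi> \<in> \<Gamma> \<longrightarrow> L \<Gamma> \<phi>) \<and>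
     (\<forall>\<Gamma> \<Delta> \<phi>. (\<forall>\<delta>\<in>\<Delta>. L \<Gamma> \<delta>) \<longrightarrow> L \<Delta> \<phi> \<longrightarrow> L \<Gamma> \<phi>) \<and>
     (\<forall>\<Gamma> \<phi> \<sigma>. L \<Gamma> \<phi> \<longrightarrow> L (subst \<sigma> ` \<Gamma>) (subst \<sigma> \<phi>)) \<and>
     (\<forall>\<Gamma> \<phi>. L \<Gamma> \<phi> \<longrightarrow> (\<exists>\<Delta>. finite \<Delta> \<and> \<Delta> \<subseteq> \<Gamma> \<and> L \<Delta> \<phi>))"

type_synonym rule = "fm set \<times> fm"

inductive add_rules :: "conseq \<Rightarrow> rule set \<Rightarrow> conseq" for L :: conseq and R :: "rule set" where
  hyp: "\<phi> \<in> \<Gamma> \<Longrightarrow> add_rules L R \<Gamma> \<phi>"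
| base: "L \<Delta> \<phi> \<Longrightarrow> (\<And>\<delta>. \<delta> \<in> \<Delta> \<Longrightarrow> add_rules L R \<Gamma> \<delta>) \<Longrightarrow> add_rules L R \<Gamma> \<phi>"
| rule: "(\<Delta>, \<psi>) \<in> R \<Longrightarrow> (\<And>\<delta>. \<delta> \<in> \<Delta> \<Longrightarrow> add_rules L R \<Gamma> (subst \<sigma> \<delta>))
           \<Longrightarrow> add_rules L R \<Gamma> (subst \<sigma> \<psi>)"

definition admissible :: "conseq \<Rightarrow> fm set \<Rightarrow> fm \<Rightarrow> bool" where
  "admissible L \<Gamma> \<phi> \<longleftrightarrow>
     (\<forall>\<sigma>. (\<forall>\<gamma>\<in>\<Gamma>. L {} (subst \<sigma> \<gamma>)) \<longrightarrow> L {} (subst \<sigma> \<phi>))"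

definition is_structural_completion :: "conseq \<Rightarrow> conseq \<Rightarrow> bool" where
  "is_structural_completion L L' \<longleftrightarrow>
     is_logic L' \<and> L \<le> L' \<and> (\<forall>\<Gamma> \<phi>. finite \<Gamma> \<longrightarrow> (L' \<Gamma> \<phi> \<longleftrightarrow> admissible L \<Gamma> \<phi>))"

definition admissible_base :: "conseq \<Rightarrow> rule set \<Rightarrow> bool" where
  "admissible_base L R \<longleftrightarrow>
     (\<forall>(\<Gamma>, \<phi>)\<in>R. finite \<Gamma>) \<and> is_structural_completion L (add_rules L R)"


section \<open>Sanity checks\<close>

lemma is_logic_mono:
  assumes "is_logic L" "L \<Delta> \<phi>" "\<Delta> \<subseteq> \<Gamma>"
  shows "L \<Gamma> \<phi>"
  using assms unfolding is_logic_def by (meson subsetD)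

lemma is_structural_completion_unique:
  assumes "is_structural_completion L L1" "is_structural_completion L L2"
  shows "L1 = L2"
proof -
  have *: "L2 \<Gamma> \<phi>" if s1: "is_structural_completion L L1" and s2: "is_structural_completion L L2"
    and d: "L1 \<Gamma> \<phi>" for L1 L2 \<Gamma> \<phi>
  proof -
    have "is_logic L1" "is_logic L2" using s1 s2 by (auto simp: is_structural_completion_def)
    then obtain \<Delta> where "finite \<Delta>" "\<Delta> \<subseteq> \<Gamma>" "L1 \<Delta> \<phi>"
      using d unfolding is_logic_def by meson
    then have "L2 \<Delta> \<phi>" using s1 s2 by (simp add: is_structural_completion_def)
    then show ?thesis using is_logic_mono \<open>is_logic L2\<close> \<open>\<Delta> \<subseteq> \<Gamma>\<close> by blast
  qed
  show ?thesis using *[OF assms] *[OF assms(2,1)] by (intro ext iffI) auto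
qed

lemma subst_subst: "subst \<tau> (subst \<sigma> \<phi>) = subst (\<lambda>n. subst \<tau> (\<sigma> n)) \<phi>"
  by (induction \<phi>) auto

lemma add_rules_cut:
  assumes "add_rules L R \<Delta> \<phi>" "\<And>\<delta>. \<delta> \<in> \<Delta> \<Longrightarrow> add_rules L R \<Gamma> \<delta>"
  shows "add_rules L R \<Gamma> \<phi>"
  using assms
proof (induction rule: add_rules.induct)
  case (base \<Delta>' \<phi> \<Delta>)
  show ?case by (rule add_rules.base[of L, OF base.hyps(1)]) (use base in blast)
next
  case (rule \<Delta>' \<psi> \<Delta> \<sigma>)
  show ?case by (rule add_rules.rule[OF rule.hyps(1)]) (use rule in blast)
qed simp

lemma add_rules_subst:
  assumes "is_logic L" "add_rules L R \<Gamma> \<phi>"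
  shows "add_rules L R (subst \<tau> ` \<Gamma>) (subst \<tau> \<phi>)"
  using assms(2)
proof (induction rule: add_rules.induct)
  case (hyp \<phi> \<Gamma>)
  then show ?case by (auto intro: add_rules.hyp)
next
  case (base \<Delta> \<phi> \<Gamma>)
  have "L (subst \<tau> ` \<Delta>) (subst \<tau> \<phi>)"
    using assms(1) base.hyps(1) unfolding is_logic_def by blast
  then show ?case by (rule add_rules.base) (use base.IH in blast)
next
  case (rule \<Delta> \<psi> \<Gamma> \<sigma>)
  show ?case unfolding subst_subst
    by (rule add_rules.rule[OF rule.hyps(1)]) (use rule.IH in \<open>simp add: subst_subst\<close>)
qed

lemma add_rules_finitary:
  assumes "is_logic L" "\<forall>(\<Gamma>, \<phi>)\<in>R. finite \<Gamma>" "add_rules L R \<Gamma> \<phi>"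
  shows "\<exists>\<Delta>. finite \<Delta> \<and> \<Delta> \<subseteq> \<Gamma> \<and> add_rules L R \<Delta> \<phi>"
proof -
  have fin: "\<exists>\<Delta>. finite \<Delta> \<and> \<Delta> \<subseteq> \<Gamma> \<and> (\<forall>\<delta>\<in>D. add_rules L R \<Delta> \<delta>)"
    if "finite D" and ex: "\<And>\<delta>. \<delta> \<in> D \<Longrightarrow> \<exists>\<Delta>. finite \<Delta> \<and> \<Delta> \<subseteq> \<Gamma> \<and> add_rules L R \<Delta> \<delta>" for D \<Gamma>
  proof -
    obtain f where f: "\<And>\<delta>. \<delta> \<in> D \<Longrightarrow> finite (f \<delta>) \<and> f \<delta> \<subseteq> \<Gamma> \<and> add_rules L R (f \<delta>) \<delta>"
      using ex by metis
    have "add_rules L R (\<Union>(f ` D)) \<delta>" if "\<delta> \<in> D" for \<delta>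
      by (rule add_rules_cut[of L R "f \<delta>"]) (use f that in \<open>auto intro: add_rules.hyp\<close>)
    then show ?thesis using f \<open>finite D\<close> by (intro exI[of _ "\<Union>(f ` D)"]) auto
  qed
  show ?thesis using assms(3)
  proof (induction rule: add_rules.induct)
    case (hyp \<phi> \<Gamma>)
    then show ?case by (intro exI[of _ "{\<phi>}"]) (auto intro: add_rules.hyp)
  next
    case (base \<Delta> \<phi> \<Gamma>)
    obtain D where D: "finite D" "D \<subseteq> \<Delta>" "L D \<phi>"
      using assms(1) base.hyps(1) unfolding is_logic_def by meson
    obtain E where "finite E" "E \<subseteq> \<Gamma>" "\<forall>\<delta>\<in>D. add_rules L R E \<delta>"
      using fin[OF D(1), of \<Gamma>] base.IH D(2) by blast
    moreover from this(3) have "add_rules L R E \<phi>" by (intro add_rules.base[of L, OF D(3)]) simp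
    ultimately show ?case by blast
  next
    case (rule \<Delta> \<psi> \<Gamma> \<sigma>)
    have "finite (subst \<sigma> ` \<Delta>)" using assms(2) rule.hyps(1) by auto
    from fin[OF this, of \<Gamma>] rule.IH
    obtain E where "finite E" "E \<subseteq> \<Gamma>" "\<forall>\<delta>\<in>subst \<sigma> ` \<Delta>. add_rules L R E \<delta>" by blast
    moreover from this(3) have "add_rules L R E (subst \<sigma> \<psi>)"
      by (intro add_rules.rule[OF rule.hyps(1)]) simp
    ultimately show ?case by blast
  qed
qed

lemma add_rules_is_logic:
  assumes "is_logic L" "\<forall>(\<Gamma>, \<phi>)\<in>R. finite \<Gamma>"
  shows "is_logic (add_rules L R)"
  unfolding is_logic_def
proof (intro conjI allI impI)
  fix \<Gamma> \<Delta> \<phi> assume "\<forall>\<delta>\<in>\<Delta>. add_rules L R \<Gamma> \<delta>" "add_rules L R \<Delta> \<phi>"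
  then show "add_rules L R \<Gamma> \<phi>" by (intro add_rules_cut[of L R \<Delta> \<phi> \<Gamma>]) simp_all
qed (simp_all add: add_rules.hyp add_rules_subst[OF assms(1)] add_rules_finitary[OF assms])

text \<open>Together with the previous lemma and \<open>add_rules.intros\<close>: \<open>add_rules L R\<close> is the least
  logic extending \<open>L\<close> that contains the rules \<open>R\<close>.\<close>

lemma add_rules_least:
  assumes "is_logic L'" "L \<le> L'" "\<And>\<Delta> \<psi>. (\<Delta>, \<psi>) \<in> R \<Longrightarrow> L' \<Delta> \<psi>"
  shows "add_rules L R \<le> L'"
proof (intro le_funI le_boolI)
  fix \<Gamma> \<phi>
  have cut: "L' \<Gamma> \<phi>" if "L' \<Delta> \<phi>" "\<And>\<delta>. \<delta> \<in> \<Delta> \<Longrightarrow> L' \<Gamma> \<delta>" for \<Gamma> \<Delta> \<phi>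
    using assms(1) that unfolding is_logic_def by meson
  assume "add_rules L R \<Gamma> \<phi>"
  then show "L' \<Gamma> \<phi>"
  proof (induction rule: add_rules.induct)
    case (hyp \<phi> \<Gamma>)
    then show ?case using assms(1) unfolding is_logic_def by blast
  next
    case (base \<Delta> \<phi> \<Gamma>)
    have "L' \<Delta> \<phi>" using base.hyps(1) assms(2) by (auto simp: le_fun_def)
    then show ?case using base.IH by (rule cut)
  next
    case (rule \<Delta> \<psi> \<Gamma> \<sigma>)
    have "L' (subst \<sigma> ` \<Delta>) (subst \<sigma> \<psi>)"
      using assms(1) assms(3)[OF rule.hyps(1)] unfolding is_logic_def by blast
    then show ?case by (rule cut) (use rule.IH in blast)
  qed
qed

instance qunit :: countable
proof
  obtain f :: "real \<Rightarrow> nat" where f: "inj_on f \<rat>"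
    using countable_rat unfolding countable_def by blast
  show "\<exists>to_nat :: qunit \<Rightarrow> nat. inj to_nat"
    by (rule exI[of _ "\<lambda>q. f (val q)"], rule injI)
      (metis f inj_onD val_in(3) val_inject)
qed

instance fm :: countable
  by countable_datatype

lemma bl_eval_closed:
  assumes "bl_algebra A" "range v \<subseteq> carrier A"
  shows "bl_eval A v t \<in> carrier A"
proof -
  interpret bl_algebra A by fact
  show ?thesis using assms(2)
    by (induction t) (auto simp: meet_closed join_closed imp_closed zero_closed)
qed

lemma eval_closed:
  assumes "rational_goedel_algebra A" "range v \<subseteq> carrier A"
  shows "eval A v t \<in> carrier A"
proof -
  interpret rational_goedel_algebra A by fact
  show ?thesis using assms(2)
    by (induction t) (auto simp: meet_closed join_closed imp_closed zero_closed const_closed)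
qed

lemma rational_goedel_algebra_embed:
  fixes A :: "('a, 'm) rbl_scheme" and B :: "('b, 'n) rbl_scheme"
  assumes "rational_goedel_algebra A"
    and g: "inj_on g (carrier B)" "g ` carrier B \<subseteq> carrier A"
    and clo: "\<And>a b. a \<in> carrier B \<Longrightarrow> b \<in> carrier B \<Longrightarrow> mult B a b \<in> carrier B"
      "\<And>a b. a \<in> carrier B \<Longrightarrow> b \<in> carrier B \<Longrightarrow> bmeet B a b \<in> carrier B"
      "\<And>a b. a \<in> carrier B \<Longrightarrow> b \<in> carrier B \<Longrightarrow> bjoin B a b \<in> carrier B"
      "\<And>a b. a \<in> carrier B \<Longrightarrow> b \<in> carrier B \<Longrightarrow> bimp B a b \<in> carrier B"
      "one B \<in> carrier B" "bzero B \<in> carrier B" "\<And>q. bconst B q \<in> carrier B"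
    and hom: "\<And>a b. a \<in> carrier B \<Longrightarrow> b \<in> carrier B \<Longrightarrow> g (mult B a b) = mult A (g a) (g b)"
      "\<And>a b. a \<in> carrier B \<Longrightarrow> b \<in> carrier B \<Longrightarrow> g (bmeet B a b) = bmeet A (g a) (g b)"
      "\<And>a b. a \<in> carrier B \<Longrightarrow> b \<in> carrier B \<Longrightarrow> g (bjoin B a b) = bjoin A (g a) (g b)"
      "\<And>a b. a \<in> carrier B \<Longrightarrow> b \<in> carrier B \<Longrightarrow> g (bimp B a b) = bimp A (g a) (g b)"
      "g (one B) = one A" "g (bzero B) = bzero A" "\<And>q. g (bconst B q) = bconst A q"
  shows "rational_goedel_algebra B"
proof -
  interpret A: rational_goedel_algebra A by fact
  have gc: "g a \<in> carrier A" if "a \<in> carrier B" for a using g that by auto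
  have eq: "a = b \<longleftrightarrow> g a = g b" if "a \<in> carrier B" "b \<in> carrier B" for a b
    using g(1) that by (auto dest: inj_onD)
  have le: "bleq B a b \<longleftrightarrow> bleq A (g a) (g b)" if "a \<in> carrier B" "b \<in> carrier B" for a b
    using that by (simp add: bleq_def eq clo hom)
  interpret B: bl_algebra B
  proof
    fix a b c assume "a \<in> carrier B" "b \<in> carrier B" "c \<in> carrier B"
    then show "bleq B (mult B a b) c \<longleftrightarrow> bleq B a (bimp B b c)"
      by (simp add: le clo hom gc A.residuation)
  qed (simp_all add: clo eq le hom gc A.m_ac A.meet_assoc A.join_assoc
      A.meet_absorb A.join_absorb A.zero_least A.one_greatest A.prelinearity A.divisibility[symmetric]
      A.meet_comm A.join_comm)
  have ev: "g (bl_eval B v t) = bl_eval A (g \<circ> v) t" if "range v \<subseteq> carrier B" for v t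
    by (induction t)
      (simp_all add: hom bl_eval_closed[OF B.bl_algebra_axioms that])
  show ?thesis
  proof
    fix s t assume "bl_valid std_goedel s t"
    then have A: "bl_valid A s t" by (rule A.goedel_equations)
    show "bl_valid B s t" unfolding bl_valid_def
    proof (intro allI impI)
      fix v :: "nat \<Rightarrow> 'b" assume v: "range v \<subseteq> carrier B"
      then have "range (g \<circ> v) \<subseteq> carrier A" using gc by auto
      then have "bl_eval A (g \<circ> v) s = bl_eval A (g \<circ> v) t" using A by (simp add: bl_valid_def)
      then show "bl_eval B v s = bl_eval B v t"
        using eq bl_eval_closed[OF B.bl_algebra_axioms v] ev[OF v] by simp
    qed
  qed (simp_all add: clo eq hom A.const_mult A.const_imp A.const_zero A.const_one)
qed

lemma rga_entails_all:
  fixes A :: "('a, 'm) rbl_scheme"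
  assumes ent: "rga_entails \<Delta> \<phi>" and A: "rational_goedel_algebra A" and v: "range v \<subseteq> carrier A"
    and prem: "\<And>\<delta>. \<delta> \<in> \<Delta> \<Longrightarrow> eval A v \<delta> = one A"
  shows "eval A v \<phi> = one A"
proof -
  interpret A: rational_goedel_algebra A by fact
  define S where "S = range (eval A v)"
  have cl: "bmeet A a b \<in> S" "bjoin A a b \<in> S" "mult A a b \<in> S" "bimp A a b \<in> S"
    if "a \<in> S" "b \<in> S" for a b
  proof -
    from that obtain s t where "a = eval A v s" "b = eval A v t" by (auto simp: S_def)
    then have "bmeet A a b = eval A v (And s t)" "bjoin A a b = eval A v (Or s t)"
      "mult A a b = eval A v (Mult s t)" "bimp A a b = eval A v (Imp s t)" by simp_all
    then show "bmeet A a b \<in> S" "bjoin A a b \<in> S" "mult A a b \<in> S" "bimp A a b \<in> S"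
      unfolding S_def by (metis rangeI)+
  qed
  have cl0: "one A \<in> S" "bzero A \<in> S" "bconst A q \<in> S" "v n \<in> S" for q n
    unfolding S_def by (metis eval.simps rangeI)+
  have sub: "S \<subseteq> carrier A" using eval_closed[OF A v] by (auto simp: S_def)
  have "countable S" by (simp add: S_def)
  define h :: "'a \<Rightarrow> real" where "h = of_nat \<circ> to_nat_on S"
  have inj: "inj_on h S"
    using inj_on_to_nat_on[OF \<open>countable S\<close>] by (auto simp: h_def inj_on_def)
  define g where "g = inv_into S h"
  have gh: "g (h a) = a" if "a \<in> S" for a using inj that by (simp add: g_def)
  define B :: "real rbl" where "B = \<lparr>carrier = h ` S, mult = (\<lambda>a b. h (mult A (g a) (g b))),
     one = h (one A), bmeet = (\<lambda>a b. h (bmeet A (g a) (g b))),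
     bjoin = (\<lambda>a b. h (bjoin A (g a) (g b))), bimp = (\<lambda>a b. h (bimp A (g a) (g b))),
     bzero = h (bzero A), bconst = (\<lambda>q. h (bconst A q))\<rparr>"
  have B: "rational_goedel_algebra B"
    by (rule rational_goedel_algebra_embed[OF A, of g])
      (use sub in \<open>auto simp: B_def gh cl cl0 inj_on_def\<close>)
  have ev: "eval B (h \<circ> v) t = h (eval A v t)" for t
    by (induction t) (simp_all add: B_def gh S_def)
  have "eval B (h \<circ> v) \<phi> = one B"
  proof -
    have "range (h \<circ> v) \<subseteq> carrier B" using cl0 by (auto simp: B_def)
    moreover have "\<forall>\<delta>\<in>\<Delta>. eval B (h \<circ> v) \<delta> = one B"
      by (simp add: ev prem) (simp add: B_def)
    ultimately show ?thesis using ent B unfolding rga_entails_def by blast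
  qed
  then have "h (eval A v \<phi>) = h (one A)" by (simp add: ev) (simp add: B_def)
  then show ?thesis using inj cl0(1) by (auto simp: S_def inj_on_def)
qed

end

theory Submission
  imports Defs
begin

text \<open>A formula that is not derivable with the additional rules has a countermodel on a chain in
  which the relevant constants below \<open>r\<close> (respectively \<open>c\<^sub>p\<close>) stay below the unit, because all
  disjunctions \<open>c\<^sub>q \<or> \<phi>\<close> fail to be derivable as well. Only finitely many values matter. A value lying
  below an infinite supply of constants can be moved to a rational constant; the finitely many
  values between \<open>c\<^sub>p\<close> and the unit are named by the formulas
  \<open>\<alpha>\<^sub>0 = c\<^sub>p\<close>, \<open>\<alpha>\<^sub>i\<^sub>+\<^sub>1 = (x\<^sub>i \<rightarrow> \<alpha>\<^sub>i) \<or> x\<^sub>i\<close>, which under every valuation increase strictly until they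
  reach the unit. Substituting for each variable the formula naming its value turns
  the premises into theorems but not the conclusion. Conversely the rule \<open>c\<^sub>q \<or> z \<rhd> z\<close> is
  admissible because a chain in which \<open>c\<^sub>q\<close> is the unit is a quotient of one in which it is not.\<close>

section \<open>Goedel algebras\<close>

text \<open>The interpretation \<open>k\<close> of the constants is left arbitrary, so constants can
  be treated like variables. Evaluation never consults the carrier \<open>D\<close>, which allows
  switching between carriers.\<close>

definition chain :: "real set \<Rightarrow> (qunit \<Rightarrow> real) \<Rightarrow> real rbl" where
  "chain D k = \<lparr>carrier = D, mult = min, one = 1, bmeet = min, bjoin = max,
     bimp = (\<lambda>a c. if a \<le> c then 1 else c), bzero = 0, bconst = k\<rparr>"

lemma chain_simps [simp]:
  "carrier (chain D k) = D" "mult (chain D k) = min" "one (chain D k) = 1"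
  "bmeet (chain D k) = min" "bjoin (chain D k) = max" "bzero (chain D k) = 0"
  "bimp (chain D k) a c = (if a \<le> c then 1 else c)" "bconst (chain D k) = k"
  by (simp_all add: chain_def)

lemma std_goedel_simps [simp]:
  "carrier std_goedel = {0..1}" "mult std_goedel = min" "one std_goedel = 1"
  "bmeet std_goedel = min" "bjoin std_goedel = max" "bzero std_goedel = 0"
  "bimp std_goedel a c = (if a \<le> c then 1 else c)"
  by (simp_all add: std_goedel_def)

lemma goedel_algebra_chain:
  assumes "D \<subseteq> {0..1}" "0 \<in> D" "1 \<in> D"
  shows "goedel_algebra (chain D k)"
proof
  fix s t assume "bl_valid std_goedel s t"
  moreover have "bl_eval (chain D k) v u = bl_eval std_goedel v u" for v u
    by (induction u) simp_all
  ultimately show "bl_valid (chain D k) s t" using assms(1) by (auto simp: bl_valid_def)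
qed (use assms in \<open>auto simp: bleq_def min_def max_def\<close>)

lemma rational_goedel_algebra_chain:
  assumes "D \<subseteq> {0..1}" "0 \<in> D" "1 \<in> D" "range k \<subseteq> D"
    and "k (Qunit 0) = 0" "k (Qunit 1) = 1"
    and "\<And>p q. k (qmult p q) = min (k p) (k q)"
    and "\<And>p q. k (qimp p q) = (if k p \<le> k q then 1 else k q)"
  shows "rational_goedel_algebra (chain D k)"
proof -
  interpret goedel_algebra "chain D k" by (rule goedel_algebra_chain) fact+
  show ?thesis by unfold_locales (use assms in auto)
qed

text \<open>In a chain, \<open>heyting_below A x y\<close> says that \<open>x < y\<close> or \<open>x = y = 1\<close>: exactly what survives
  of a strict inequality under homomorphisms.\<close>

definition heyting_below :: "('a, 'm) bl_scheme \<Rightarrow> 'a \<Rightarrow> 'a \<Rightarrow> bool" where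
  "heyting_below A x y \<longleftrightarrow> bmeet A x y = x \<and> bimp A y x = x"

lemma heyting_below_chain: "heyting_below (chain D k) x y \<longleftrightarrow> x < y \<or> x = y \<and> y = 1"
  by (auto simp: heyting_below_def min_def)

lemma bl_valid_stdI:
  assumes "\<And>v. 0 \<le> v 0 \<Longrightarrow> v 0 \<le> 1 \<Longrightarrow> 0 \<le> v 1 \<Longrightarrow> v 1 \<le> 1
    \<Longrightarrow> bl_eval std_goedel v s = bl_eval std_goedel v t"
  shows "bl_valid std_goedel s t"
  using assms by (simp add: bl_valid_def image_subset_iff)

section \<open>Identities inherited from the unit interval\<close>

context goedel_algebra
begin

text \<open>Turns an identity checked by case distinction on \<open>[0,1]\<close> into a law of
  every Goedel algebra; all variables with index from 2 on receive \<open>z\<close>.\<close>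

lemma goedel_equation3:
  assumes "bl_valid std_goedel s t" "x \<in> carrier A" "y \<in> carrier A" "z \<in> carrier A"
  shows "bl_eval A (\<lambda>n. if n = 0 then x else if n = 1 then y else z) s =
         bl_eval A (\<lambda>n. if n = 0 then x else if n = 1 then y else z) t"
proof -
  have "range (\<lambda>n :: nat. if n = 0 then x else if n = 1 then y else z) \<subseteq> carrier A"
    using assms(2-4) by auto
  then show ?thesis using goedel_equations[OF assms(1)] unfolding bl_valid_def by blast
qed

lemma mult_eq_meet:
  assumes "x \<in> carrier A" "y \<in> carrier A"
  shows "x \<otimes> y = bmeet A x y"
proof -
  have "bl_valid std_goedel (BMult (BVar 0) (BVar 1)) (BMeet (BVar 0) (BVar 1))"
    by (simp add: bl_valid_def)
  from goedel_equation3[OF this assms assms(2)] show ?thesis by simp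
qed

lemma meet_idem [simp]:
  assumes "x \<in> carrier A"
  shows "bmeet A x x = x"
proof -
  have "bl_valid std_goedel (BMeet (BVar 0) (BVar 0)) (BVar 0)"
    by (simp add: bl_valid_def)
  from goedel_equation3[OF this assms assms assms] show ?thesis by simp
qed

lemma join_idem [simp]: "x \<in> carrier A \<Longrightarrow> bjoin A x x = x"
  using join_absorb[of x x] by simp

lemma meet_imp_right:
  assumes "x \<in> carrier A" "y \<in> carrier A"
  shows "bimp A (bmeet A x y) y = \<one>"
proof -
  have "bl_valid std_goedel (BImp (BMeet (BVar 0) (BVar 1)) (BVar 1)) BOne"
    by (simp add: bl_valid_def)
  from goedel_equation3[OF this assms assms(2)] show ?thesis by simp
qed

lemma imp_self [simp]: "x \<in> carrier A \<Longrightarrow> bimp A x x = \<one>"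
  using meet_imp_right[of x x] by simp

lemma one_imp [simp]:
  assumes "x \<in> carrier A"
  shows "bimp A \<one> x = x"
proof -
  have "bl_valid std_goedel (BImp BOne (BVar 0)) (BVar 0)"
    by (rule bl_valid_stdI) auto
  from goedel_equation3[OF this assms assms assms] show ?thesis by simp
qed

lemma heyting_below_one: "x \<in> carrier A \<Longrightarrow> heyting_below A x \<one>"
  using one_greatest[of x] by (simp add: heyting_below_def bleq_def)

lemma heyting_below_trans:
  assumes "x \<in> carrier A" "y \<in> carrier A" "z \<in> carrier A"
    and "heyting_below A x y" "heyting_below A y z"
  shows "heyting_below A x z"
proof -
  have xy: "bmeet A x y = x" "bimp A y x = x" and yz: "bmeet A y z = y"
    using assms by (auto simp: heyting_below_def)
  \<comment> \<open>The first identity gives \<open>z \<rightarrow> x \<le> (y \<and> z)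
    \<rightarrow> x = y \<rightarrow> x = x\<close>, the second
    \<open>x \<le> z \<rightarrow> x\<close>; hence \<open>z \<rightarrow> x = x\<close>.\<close>
  have "bl_valid std_goedel
      (BMeet (BImp (BMeet (BVar 1) (BVar 2)) (BVar 0)) (BImp (BVar 2) (BVar 0)))
      (BImp (BVar 2) (BVar 0))"
    "bl_valid std_goedel (BMeet (BVar 0) (BImp (BVar 2) (BVar 0))) (BVar 0)"
    by (rule bl_valid_stdI, simp add: min_def)+
  from this[THEN goedel_equation3, OF assms(1-3)]
  have "bmeet A x (bimp A z x) = bimp A z x" "bmeet A x (bimp A z x) = x"
    by (simp_all add: xy yz)
  moreover have "bmeet A x z = x"
    using meet_assoc[OF assms(1-3)] xy yz by simp
  ultimately show ?thesis by (simp add: heyting_below_def)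
qed

text \<open>In a chain, \<open>y \<le> x\<close> makes the implication the unit; otherwise the
  implication is \<open>x\<close> and the join is \<open>y > x\<close>. So every choice of
  \<open>y\<close> yields the unit or an element strictly above \<open>x\<close>, the pattern behind
  \<open>rung\<close>.\<close>

lemma heyting_below_step:
  assumes "x \<in> carrier A" "y \<in> carrier A"
  shows "heyting_below A x (bjoin A (bimp A y x) y)"
proof -
  have "bl_valid std_goedel
      (BMeet (BVar 0) (BJoin (BImp (BVar 1) (BVar 0)) (BVar 1))) (BVar 0)"
    "bl_valid std_goedel (BImp (BJoin (BImp (BVar 1) (BVar 0)) (BVar 1)) (BVar 0)) (BVar 0)"
    by (rule bl_valid_stdI, simp add: min_def max_def)+
  from this[THEN goedel_equation3, OF assms assms(2)]
  show ?thesis by (simp add: heyting_below_def)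
qed

end

text \<open>For \<open>p\<close> below \<open>q\<close>, the product of the two is \<open>p\<close>
  and \<open>q \<rightarrow> p\<close> is \<open>p\<close>; the corresponding bookkeeping equations
  are the two clauses of \<open>heyting_below\<close>.\<close>

lemma bconst_heyting_below:
  assumes "rational_goedel_algebra A" "val p < val q"
  shows "heyting_below A (bconst A p) (bconst A q)"
proof -
  interpret rational_goedel_algebra A by fact
  have "qmult p q = p" "qimp q p = p"
    using assms(2) by (simp_all add: val_inject[symmetric] val_qmult val_qimp)
  then show ?thesis
    using const_mult[of p q] const_imp[of q p] mult_eq_meet[OF const_closed const_closed]
    by (simp add: heyting_below_def)
qed


section \<open>Homomorphisms out of chains\<close>

primrec vars :: "fm \<Rightarrow> nat set" where
  "vars (Var n) = {n}"
| "vars (Const q) = {}"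
| "vars (And \<phi> \<psi>) = vars \<phi> \<union> vars \<psi>"
| "vars (Or \<phi> \<psi>) = vars \<phi> \<union> vars \<psi>"
| "vars (Mult \<phi> \<psi>) = vars \<phi> \<union> vars \<psi>"
| "vars (Imp \<phi> \<psi>) = vars \<phi> \<union> vars \<psi>"
| "vars Zero = {}"
| "vars One = {}"

primrec constants :: "fm \<Rightarrow> qunit set" where
  "constants (Var n) = {}"
| "constants (Const q) = {q}"
| "constants (And \<phi> \<psi>) = constants \<phi> \<union> constants \<psi>"
| "constants (Or \<phi> \<psi>) = constants \<phi> \<union> constants \<psi>"
| "constants (Mult \<phi> \<psi>) = constants \<phi> \<union> constants \<psi>"
| "constants (Imp \<phi> \<psi>) = constants \<phi> \<union> constants \<psi>"
| "constants Zero = {}"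
| "constants One = {}"

lemma finite_vars [simp]: "finite (vars \<phi>)" and finite_constants [simp]: "finite (constants \<phi>)"
  by (induction \<phi>) auto

lemma eval_subst: "eval A v (subst \<sigma> \<phi>) = eval A (\<lambda>n. eval A v (\<sigma> n)) \<phi>"
  by (induction \<phi>) simp_all

text \<open>On a chain each operation returns an argument or the unit, so any \<open>D\<close>
  containing 0 and 1 is closed, and the equations in \<open>heyting_below\<close> determine all
  operations on \<open>F d\<close> and \<open>F e\<close>. The conditions on \<open>v\<close> and
  \<open>k\<close> concern only the symbols of \<phi>, which makes finite approximations
  possible.\<close>

lemma chain_hom:
  fixes A :: "('a, 'm) rbl_scheme"
  assumes "goedel_algebra A" and "0 \<in> D" "1 \<in> D" and FD: "F ` D \<subseteq> carrier A"
    and F: "F 0 = bzero A" "F 1 = one A"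
      "\<And>d e. d \<in> D \<Longrightarrow> e \<in> D \<Longrightarrow> d < e \<Longrightarrow> heyting_below A (F d) (F e)"
    and "\<And>n. n \<in> vars \<phi> \<Longrightarrow> v n \<in> D \<and> F (v n) = w n"
    and "\<And>q. q \<in> constants \<phi> \<Longrightarrow> k q \<in> D \<and> F (k q) = bconst A q"
  shows "eval (chain C k) v \<phi> \<in> D \<and> F (eval (chain C k) v \<phi>) = eval A w \<phi>"
proof -
  interpret goedel_algebra A by fact
  have Fc: "F d \<in> carrier A" if "d \<in> D" for d using FD that by blast
  have below: "bmeet A (F d) (F e) = F d" "bimp A (F e) (F d) = F d"
    "bmeet A (F e) (F d) = F d" "bjoin A (F d) (F e) = F e" "bjoin A (F e) (F d) = F e"
    "bimp A (F d) (F e) = \<one>\<^bsub>A\<^esub>" if "d < e" "d \<in> D" "e \<in> D" for d e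
  proof -
    show meet: "bmeet A (F d) (F e) = F d" "bimp A (F e) (F d) = F d"
      using F(3)[OF that(2,3,1)] by (auto simp: heyting_below_def)
    then show "bmeet A (F e) (F d) = F d" "bjoin A (F d) (F e) = F e" "bjoin A (F e) (F d) = F e"
      "bimp A (F d) (F e) = \<one>\<^bsub>A\<^esub>"
      using meet_comm[of "F d" "F e"] join_comm[of "F d" "F e"]
        join_absorb[of "F e" "F d"] meet_imp_right[of "F d" "F e"] Fc that by simp_all
  qed
  have hom: "F (min d e) = bmeet A (F d) (F e)" "F (max d e) = bjoin A (F d) (F e)"
      "F (if d \<le> e then 1 else e) = bimp A (F d) (F e)"
    if "d \<in> D" "e \<in> D" for d e
    using that Fc[OF that(1)] Fc[OF that(2)]
    by (cases d e rule: linorder_cases; simp add: F below)+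
  have closed: "min d e \<in> D" "max d e \<in> D" "(if d \<le> e then 1 else e) \<in> D"
    if "d \<in> D" "e \<in> D" for d e
    using that assms(3) by (simp_all add: min_def max_def)
  show ?thesis using assms(8,9)
  proof (induction \<phi>)
    case (Mult \<phi> \<psi>)
    then show ?case
      using mult_eq_meet[OF Fc Fc, of "eval (chain C k) v \<phi>" "eval (chain C k) v \<psi>"]
      by (simp add: hom closed)
  qed (simp_all add: hom closed assms(2,3) F(1,2))
qed

text \<open>The instance of \<open>chain_hom\<close> for the identity map on
  \<open>C\<close>.\<close>

lemma eval_chain_closed:
  assumes "C \<subseteq> {0..1}" "0 \<in> C" "1 \<in> C" "\<And>n. v n \<in> C" "\<And>q. k q \<in> C"
  shows "eval (chain D k) v \<phi> \<in> C"
  using chain_hom[of "chain C k" C "\<lambda>x. x" \<phi> v v k D] goedel_algebra_chain[of C k] assms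
  by (auto simp: heyting_below_chain)

text \<open>The quotient map of the chain by the filter of all elements from \<open>t\<close>
  on.\<close>

definition collapse :: "real \<Rightarrow> real \<Rightarrow> real" where
  "collapse t x = (if t \<le> x then 1 else x)"

text \<open>For \<open>d < e\<close> the images stay strictly ordered if \<open>d < t\<close> and
  are both 1 otherwise, so \<open>chain_hom\<close> applies.\<close>

lemma eval_collapse:
  assumes "0 < t" "t \<le> 1" "\<And>n. v n \<in> {0..1}" "\<And>q. k q \<in> {0..1}"
  shows "collapse t (eval (chain C k) v \<phi>) = eval (chain C' (collapse t \<circ> k)) (collapse t \<circ> v) \<phi>"
proof -
  have ev: "eval (chain C' k) v \<phi> = eval (chain {0..1} k) v \<phi>" for C' k v
    by (induction \<phi>) simp_all
  have "collapse t (eval (chain C k) v \<phi>)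
      = eval (chain {0..1} (collapse t \<circ> k)) (collapse t \<circ> v) \<phi>"
    by (rule chain_hom[where D = "{0..1}", THEN conjunct2])
      (use assms in \<open>auto simp: goedel_algebra_chain collapse_def heyting_below_chain\<close>)
  then show ?thesis by (subst ev)
qed


section \<open>Countermodels in the standard algebra\<close>

text \<open>Constants become fresh variables: even indices hold the propositional variables, odd
  ones the constants, numbered by countability.\<close>

primrec term_of_fm :: "fm \<Rightarrow> bl_term" where
  "term_of_fm (Var n) = BVar (2 * n)"
| "term_of_fm (Const q) = BVar (2 * to_nat q + 1)"
| "term_of_fm (And \<phi> \<psi>) = BMeet (term_of_fm \<phi>) (term_of_fm \<psi>)"
| "term_of_fm (Or \<phi> \<psi>) = BJoin (term_of_fm \<phi>) (term_of_fm \<psi>)"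
| "term_of_fm (Mult \<phi> \<psi>) = BMult (term_of_fm \<phi>) (term_of_fm \<psi>)"
| "term_of_fm (Imp \<phi> \<psi>) = BImp (term_of_fm \<phi>) (term_of_fm \<psi>)"
| "term_of_fm Zero = BZero"
| "term_of_fm One = BOne"

lemma bl_eval_term_of_fm:
  "bl_eval A (\<lambda>n. if even n then v (n div 2) else bconst A (from_nat (n div 2))) (term_of_fm \<phi>)
     = eval A v \<phi>"
  by (induction \<phi>) simp_all

text \<open>Read backwards: a valuation of the terms is a valuation of the formula variables
  together with an interpretation of the constants, possibly one violating the bookkeeping
  equations.\<close>

lemma bl_eval_std_term_of_fm:
  "bl_eval std_goedel u (term_of_fm \<phi>)
     = eval (chain D (\<lambda>q. u (2 * to_nat q + 1))) (\<lambda>n. u (2 * n)) \<phi>"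
  by (induction \<phi>) simp_all

lemma eval_big_and_chain:
  assumes "\<And>n. v n \<in> {0..1}" "\<And>q. k q \<in> {0..1}"
  shows "eval (chain C k) v (foldr And \<phi>s One) = 1 \<longleftrightarrow> (\<forall>\<phi>\<in>set \<phi>s. eval (chain C k) v \<phi> = 1)"
proof -
  have "eval (chain C k) v \<phi> \<le> 1" for \<phi>
    using eval_chain_closed[of "{0..1}" v k C \<phi>] assms by auto
  then show ?thesis by (induction \<phi>s) (auto simp: min_def antisym)
qed

lemma eval_Iff_chain:
  assumes "\<And>n. v n \<in> {0..1}" "\<And>q. k q \<in> {0..1}"
  shows "eval (chain C k) v (Iff \<phi> \<psi>) = 1 \<longleftrightarrow> eval (chain C k) v \<phi> = eval (chain C k) v \<psi>"
proof -
  have "eval (chain C k) v \<phi> \<le> 1" for \<phi>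
    using eval_chain_closed[of "{0..1}" v k C \<phi>] assms by auto
  from this[of \<phi>] this[of \<psi>] show ?thesis by (auto simp: Iff_def min_def)
qed

text \<open>What remains of a rational Goedel chain when only the order of the constants in
  \<open>K\<close> is controlled. Equality at 1 is allowed because a top segment of the constants
  may be collapsed to the unit.\<close>

definition partial_valuation :: "qunit set \<Rightarrow> (qunit \<Rightarrow> real) \<Rightarrow> (nat \<Rightarrow> real) \<Rightarrow> bool" where
  "partial_valuation K k v \<longleftrightarrow> (\<forall>n. v n \<in> {0..1}) \<and> (\<forall>q. k q \<in> {0..1}) \<and>
     k (Qunit 0) = 0 \<and> k (Qunit 1) = 1 \<and>
     (\<forall>p\<in>K. \<forall>q\<in>K. val p < val q \<longrightarrow> k p < k q \<or> k p = 1 \<and> k q = 1)"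

lemma partial_valuationD:
  assumes "partial_valuation K k v"
  shows "v n \<in> {0..1}" "k q \<in> {0..1}" "k (Qunit 0) = 0" "k (Qunit 1) = 1"
    "p \<in> K \<Longrightarrow> q \<in> K \<Longrightarrow> val p < val q \<Longrightarrow> k p < k q \<or> k p = 1 \<and> k q = 1"
  using assms unfolding partial_valuation_def by blast+

text \<open>Only finitely many constants are controlled, so that their order is expressed by a single
  formula; reading constants as variables, the equations of the standard algebra apply.\<close>

lemma chain_countermodel:
  assumes fin: "finite \<Delta>" "finite K" and not: "\<not> rga_entails \<Delta> \<psi>"
  obtains k v where "partial_valuation K k v"
    "\<forall>\<delta>\<in>\<Delta>. eval (chain {0..1} k) v \<delta> = 1" "eval (chain {0..1} k) v \<psi> < 1"
proof -
  \<comment> \<open>The implications between constants of \<open>K\<close>, together with the two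
    bounds, fix the order of \<open>K\<close>.\<close>
  define diagram where "diagram = {Iff (Imp (Const p) (Const q)) (Const (qimp p q)) | p q. p \<in> K \<and> q \<in> K}
     \<union> {Iff (Const (Qunit 0)) Zero, Iff (Const (Qunit 1)) One}"
  have "diagram = (\<lambda>(p, q). Iff (Imp (Const p) (Const q)) (Const (qimp p q))) ` (K \<times> K)
     \<union> {Iff (Const (Qunit 0)) Zero, Iff (Const (Qunit 1)) One}"
    unfolding diagram_def by auto
  then have "finite (\<Delta> \<union> diagram)" using fin by simp
  then obtain \<phi>s where \<phi>s: "set \<phi>s = \<Delta> \<union> diagram" using finite_list by blast
  let ?\<beta> = "foldr And \<phi>s One"
  \<comment> \<open>Otherwise the implication would hold in the algebra refuting the entailment,
    where its antecedent is the unit.\<close>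
  have "\<not> bl_valid std_goedel (term_of_fm (Imp ?\<beta> \<psi>)) BOne"
  proof
    assume valid: "bl_valid std_goedel (term_of_fm (Imp ?\<beta> \<psi>)) BOne"
    from not obtain A :: "real rbl" and v where A: "rational_goedel_algebra A"
      and v: "range v \<subseteq> carrier A" and \<Delta>: "\<forall>\<delta>\<in>\<Delta>. eval A v \<delta> = one A" and \<psi>: "eval A v \<psi> \<noteq> one A"
      unfolding rga_entails_def by blast
    interpret rational_goedel_algebra A by fact
    have Iff: "eval A v (Iff \<phi> \<phi>') = one A" if "eval A v \<phi> = eval A v \<phi>'" for \<phi> \<phi>'
      using that eval_closed[OF A v] by (simp add: Iff_def)
    have "eval A v \<phi> = one A" if "\<phi> \<in> set \<phi>s" for \<phi>
      using that \<Delta> by (auto simp: \<phi>s diagram_def const_imp const_zero const_one intro!: Iff)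
    then have \<beta>: "eval A v ?\<beta> = one A" by (induction \<phi>s) auto
    let ?u = "\<lambda>n. if even n then v (n div 2) else bconst A (from_nat (n div 2))"
    have "range ?u \<subseteq> carrier A" using v const_closed by auto
    then have "bl_eval A ?u (term_of_fm (Imp ?\<beta> \<psi>)) = bl_eval A ?u BOne"
      using goedel_equations[OF valid] unfolding bl_valid_def by blast
    then have "eval A v (Imp ?\<beta> \<psi>) = one A" unfolding bl_eval_term_of_fm by simp
    then show False using \<psi> \<beta> eval_closed[OF A v] by simp
  qed
  then obtain u where u: "range u \<subseteq> {0..1}" and "bl_eval std_goedel u (term_of_fm (Imp ?\<beta> \<psi>)) \<noteq> 1"
    by (auto simp: bl_valid_def)
  define k0 where "k0 = (\<lambda>q :: qunit. u (2 * to_nat q + 1))"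
  define v0 where "v0 = (\<lambda>n. u (2 * n))"
  have rng: "v0 n \<in> {0..1}" "k0 q \<in> {0..1}" for n q 
    using u by (simp_all add: v0_def k0_def image_subset_iff)
  \<comment> \<open>A failing implication only puts \<psi> below the value \<open>t\<close> of the
    conjunction. Collapsing from \<open>t\<close> on makes all conjuncts true and leaves \<psi>
    below 1.\<close>
  define t where "t = eval (chain {0..1} k0) v0 ?\<beta>"
  have less: "eval (chain {0..1} k0) v0 \<psi> < t"
    using \<open>bl_eval std_goedel u (term_of_fm (Imp ?\<beta> \<psi>)) \<noteq> 1\<close>
    by (auto simp: bl_eval_std_term_of_fm[of _ _ "{0..1}"] t_def k0_def v0_def split: if_splits)
  have t: "0 < t" "t \<le> 1"
    using less eval_chain_closed[of "{0..1}" v0 k0 "{0..1}" \<psi>]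
      eval_chain_closed[of "{0..1}" v0 k0 "{0..1}" ?\<beta>] rng by (auto simp: t_def)
  define k v where "k = collapse t \<circ> k0" and "v = collapse t \<circ> v0"
  have col: "eval (chain {0..1} k) v \<phi> = collapse t (eval (chain {0..1} k0) v0 \<phi>)" for \<phi>
    unfolding k_def v_def using eval_collapse[of t v0 k0 "{0..1}" \<phi> "{0..1}", OF t rng] by simp
  have rng': "v n \<in> {0..1}" "k q \<in> {0..1}" for n q
    using rng(1)[of n] rng(2)[of q] by (auto simp: k_def v_def collapse_def)
  have all: "\<forall>\<phi>\<in>set \<phi>s. eval (chain {0..1} k) v \<phi> = 1"
    using eval_big_and_chain[of v k "{0..1}" \<phi>s] rng' col[of ?\<beta>] by (simp add: t_def collapse_def)
  note Iff = eval_Iff_chain[of v k "{0..1}", OF rng']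
  have k01: "k (Qunit 0) = 0" "k (Qunit 1) = 1"
    using all Iff[of "Const (Qunit 0)" Zero] Iff[of "Const (Qunit 1)" One]
    by (auto simp: \<phi>s diagram_def)
  have imp: "(if k p \<le> k q then 1 else k q) = k (qimp p q)" if "p \<in> K" "q \<in> K" for p q
  proof -
    have "Iff (Imp (Const p) (Const q)) (Const (qimp p q)) \<in> set \<phi>s"
      using that by (auto simp: \<phi>s diagram_def)
    then show ?thesis
      using all Iff[of "Imp (Const p) (Const q)" "Const (qimp p q)"] by simp
  qed
  have "k p < k q \<or> k p = 1 \<and> k q = 1" if "p \<in> K" "q \<in> K" "val p < val q" for p q
  proof -
    \<comment> \<open>The diagram entries for the two implications exclude
      \<open>k q \<le> k p\<close> unless both values are 1.\<close>
    have "qimp p q = Qunit 1" using that(3) by (simp add: qimp_def)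
    moreover have "qimp q p = p" using that(3) by (simp add: val_inject[symmetric] val_qimp)
    ultimately show ?thesis
      using imp[OF that(1,2)] imp[OF that(2,1)] k01 rng'(2)[of q] rng'(2)[of p]
      by (auto split: if_splits)
  qed
  then have "partial_valuation K k v" using rng' k01 by (simp add: partial_valuation_def)
  moreover have "eval (chain {0..1} k) v \<psi> < 1"
    using less t by (simp add: col collapse_def)
  ultimately show thesis using that[of k v] all \<phi>s by simp
qed


section \<open>Logics given by axioms\<close>

lemma is_logic_RG: "is_logic RG"
  unfolding is_logic_def
proof (intro conjI allI impI)
  fix \<Gamma> :: "fm set" and \<phi> assume "\<phi> \<in> \<Gamma>"
  then show "RG \<Gamma> \<phi>"
    unfolding RG_def rga_entails_def by (intro exI[of _ "{\<phi>}"]) auto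
next
  fix \<Gamma> \<Delta> \<phi> assume \<Delta>: "\<forall>\<delta>\<in>\<Delta>. RG \<Gamma> \<delta>" and "RG \<Delta> \<phi>"
  then obtain E where E: "finite E" "E \<subseteq> \<Delta>" "rga_entails E \<phi>" unfolding RG_def by blast
  have "\<forall>\<delta>\<in>E. \<exists>D. finite D \<and> D \<subseteq> \<Gamma> \<and> rga_entails D \<delta>" using \<Delta> E(2) unfolding RG_def by blast
  then obtain D where D: "\<And>\<delta>. \<delta> \<in> E \<Longrightarrow> finite (D \<delta>) \<and> D \<delta> \<subseteq> \<Gamma> \<and> rga_entails (D \<delta>) \<delta>"
    by metis
  have "rga_entails (\<Union>(D ` E)) \<phi>"
    unfolding rga_entails_def
  proof (intro allI impI, elim conjE)
    fix A :: "real rbl" and v assume A: "rational_goedel_algebra A" "range v \<subseteq> carrier A"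
      and prem: "\<forall>\<delta>\<in>\<Union>(D ` E). eval A v \<delta> = one A"
    have "eval A v \<delta> = one A" if "\<delta> \<in> E" for \<delta>
      using D[OF that] A prem that unfolding rga_entails_def by blast
    then show "eval A v \<phi> = one A" using E(3) A unfolding rga_entails_def by blast
  qed
  then show "RG \<Gamma> \<phi>" unfolding RG_def using D E(1) by (intro exI[of _ "\<Union>(D ` E)"]) auto
next
  fix \<Gamma> \<phi> \<sigma> assume "RG \<Gamma> \<phi>"
  then obtain E where E: "finite E" "E \<subseteq> \<Gamma>" "rga_entails E \<phi>" unfolding RG_def by blast
  have "rga_entails (subst \<sigma> ` E) (subst \<sigma> \<phi>)"
    unfolding rga_entails_def
  proof (intro allI impI, elim conjE)
    fix A :: "real rbl" and v assume A: "rational_goedel_algebra A" "range v \<subseteq> carrier A"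
      and prem: "\<forall>\<delta>\<in>subst \<sigma> ` E. eval A v \<delta> = one A"
    have "range (\<lambda>n. eval A v (\<sigma> n)) \<subseteq> carrier A" using eval_closed[OF A] by auto
    then show "eval A v (subst \<sigma> \<phi>) = one A"
      using E(3) A(1) prem unfolding rga_entails_def by (auto simp: eval_subst)
  qed
  then show "RG (subst \<sigma> ` \<Gamma>) (subst \<sigma> \<phi>)"
    unfolding RG_def using E(1,2) by (intro exI[of _ "subst \<sigma> ` E"]) auto
next
  fix \<Gamma> \<phi> assume "RG \<Gamma> \<phi>"
  then show "\<exists>\<Delta>. finite \<Delta> \<and> \<Delta> \<subseteq> \<Gamma> \<and> RG \<Delta> \<phi>" unfolding RG_def by blast
qed

definition instances :: "fm set \<Rightarrow> fm set" where
  "instances \<Sigma> = {subst \<sigma> s | \<sigma> s. s \<in> \<Sigma>}"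

lemma add_axioms_instances: "add_axioms L \<Sigma> \<Gamma> \<phi> \<longleftrightarrow> L (\<Gamma> \<union> instances \<Sigma>) \<phi>"
  by (simp add: add_axioms_def instances_def)

lemma instances_mono: "\<Sigma> \<subseteq> \<Sigma>' \<Longrightarrow> instances \<Sigma> \<subseteq> instances \<Sigma>'"
  unfolding instances_def by blast

lemma subst_instances: "subst \<tau> ` instances \<Sigma> \<subseteq> instances \<Sigma>"
  unfolding instances_def using subst_subst by blast

lemma is_logic_add_axioms:
  assumes L: "is_logic L"
  shows "is_logic (add_axioms L \<Sigma>)"
  unfolding is_logic_def add_axioms_instances
proof (intro conjI allI impI)
  have refl: "L \<Gamma> \<phi>" if "\<phi> \<in> \<Gamma>" for \<Gamma> \<phi>
    using L that unfolding is_logic_def by blast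
  fix \<Gamma> :: "fm set" and \<phi>
  show "L (\<Gamma> \<union> instances \<Sigma>) \<phi>" if "\<phi> \<in> \<Gamma>" using refl that by blast
  show "L (\<Gamma> \<union> instances \<Sigma>) \<phi>"
    if "\<forall>\<delta>\<in>\<Delta>. L (\<Gamma> \<union> instances \<Sigma>) \<delta>" "L (\<Delta> \<union> instances \<Sigma>) \<phi>" for \<Delta>
  proof -
    have "\<forall>\<delta>\<in>\<Delta> \<union> instances \<Sigma>. L (\<Gamma> \<union> instances \<Sigma>) \<delta>" using that(1) refl by blast
    then show ?thesis using L that(2) unfolding is_logic_def by blast
  qed
  assume \<phi>: "L (\<Gamma> \<union> instances \<Sigma>) \<phi>"
  show "L (subst \<sigma> ` \<Gamma> \<union> instances \<Sigma>) (subst \<sigma> \<phi>)" for \<sigma>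
  proof (rule is_logic_mono[OF L])
    show "L (subst \<sigma> ` (\<Gamma> \<union> instances \<Sigma>)) (subst \<sigma> \<phi>)"
      using L \<phi> unfolding is_logic_def by blast
  qed (use subst_instances in blast)
  obtain D where D: "finite D" "D \<subseteq> \<Gamma> \<union> instances \<Sigma>" "L D \<phi>"
    using L \<phi> unfolding is_logic_def by meson
  have "L (D \<inter> \<Gamma> \<union> instances \<Sigma>) \<phi>" by (rule is_logic_mono[OF L D(3)]) (use D(2) in blast)
  then show "\<exists>\<Delta>. finite \<Delta> \<and> \<Delta> \<subseteq> \<Gamma> \<and> L (\<Delta> \<union> instances \<Sigma>) \<phi>" using D(1) by blast
qed

lemma add_axioms_add_axioms: "add_axioms (add_axioms L \<Sigma>) \<Sigma>' = add_axioms L (\<Sigma> \<union> \<Sigma>')"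
proof (intro ext)
  fix \<Gamma> \<phi>
  have "\<Gamma> \<union> instances \<Sigma>' \<union> instances \<Sigma> = \<Gamma> \<union> instances (\<Sigma> \<union> \<Sigma>')"
    by (auto simp: instances_def)
  then show "add_axioms (add_axioms L \<Sigma>) \<Sigma>' \<Gamma> \<phi> = add_axioms L (\<Sigma> \<union> \<Sigma>') \<Gamma> \<phi>"
    by (simp add: add_axioms_instances)
qed

lemma add_axioms_RGI:
  assumes "finite \<Delta>" "\<Delta> \<subseteq> \<Gamma> \<union> instances \<Sigma>" "rga_entails \<Delta> \<phi>"
  shows "add_axioms RG \<Sigma> \<Gamma> \<phi>"
  using assms unfolding add_axioms_instances RG_def by blast

definition models :: "('a, 'm) rbl_scheme \<Rightarrow> fm set \<Rightarrow> bool" where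
  "models A \<Sigma> \<longleftrightarrow> (\<forall>s\<in>\<Sigma>. \<forall>v. range v \<subseteq> carrier A \<longrightarrow> eval A v s = one A)"

lemma add_axioms_RG_sound:
  assumes "add_axioms RG \<Sigma> {} \<phi>" and A: "rational_goedel_algebra A" "range v \<subseteq> carrier A"
    and "models A \<Sigma>"
  shows "eval A v \<phi> = one A"
proof -
  obtain \<Delta> where \<Delta>: "\<Delta> \<subseteq> instances \<Sigma>" "rga_entails \<Delta> \<phi>"
    using assms(1) unfolding add_axioms_instances RG_def by auto
  show ?thesis
  proof (rule rga_entails_all[OF \<Delta>(2) A])
    fix \<delta> assume "\<delta> \<in> \<Delta>"
    then obtain \<sigma> s where "\<delta> = subst \<sigma> s" "s \<in> \<Sigma>" using \<Delta>(1) by (auto simp: instances_def)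
    moreover have "range (\<lambda>n. eval A v (\<sigma> n)) \<subseteq> carrier A" using eval_closed[OF A] by auto
    ultimately show "eval A v \<delta> = one A" using assms(4) by (simp add: models_def eval_subst)
  qed
qed

text \<open>Since the added rules are admissible, a substitution turning the premises of a
  derivation into theorems does so for every step; thus derivable rules are admissible. The converse
  remains as a premise in contrapositive form, to be met by a substitution making all of \<Gamma>
  theorems but not \<phi>.\<close>

lemma admissible_baseI:
  assumes L: "is_logic L" and R: "\<And>\<Delta> \<psi>. (\<Delta>, \<psi>) \<in> R \<Longrightarrow> finite \<Delta> \<and> admissible L \<Delta> \<psi>"
    and complete: "\<And>\<Gamma> \<phi>. finite \<Gamma> \<Longrightarrow> \<not> add_rules L R \<Gamma> \<phi> \<Longrightarrow> \<not> admissible L \<Gamma> \<phi>"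
  shows "admissible_base L R"
proof -
  have sound: "L {} (subst \<sigma> \<phi>)"
    if "add_rules L R \<Gamma> \<phi>" "\<forall>\<gamma>\<in>\<Gamma>. L {} (subst \<sigma> \<gamma>)" for \<Gamma> \<phi> \<sigma>
    using that
  proof (induction rule: add_rules.induct)
    case (base \<Delta> \<phi> \<Gamma>)
    have "L (subst \<sigma> ` \<Delta>) (subst \<sigma> \<phi>)"
      using L base.hyps(1) unfolding is_logic_def by blast
    moreover have "\<forall>\<delta>\<in>subst \<sigma> ` \<Delta>. L {} \<delta>" using base.IH base.prems by blast
    ultimately show ?case using L unfolding is_logic_def by blast
  next
    case (rule \<Delta> \<psi> \<Gamma> \<tau>)
    then have "\<forall>\<delta>\<in>\<Delta>. L {} (subst (\<lambda>n. subst \<sigma> (\<tau> n)) \<delta>)" by (simp add: subst_subst)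
    then show ?case using R[OF rule.hyps(1)] unfolding admissible_def subst_subst by blast
  qed simp
  have "is_logic (add_rules L R)" by (rule add_rules_is_logic) (use L R in auto)
  moreover have "L \<le> add_rules L R"
    by (intro le_funI le_boolI) (blast intro: add_rules.intros)
  moreover have "add_rules L R \<Gamma> \<phi> \<longleftrightarrow> admissible L \<Gamma> \<phi>" if "finite \<Gamma>" for \<Gamma> \<phi>
    using sound complete[OF that] unfolding admissible_def by blast
  ultimately show ?thesis
    using R by (auto simp: admissible_base_def is_structural_completion_def)
qed


section \<open>Ladders above a truncated chain of constants\<close>

lemma cst_val [simp]: "cst (val q) = Const q"
  by (simp add: cst_def val_inverse)

lemma val_Qunit [simp]: "x \<in> {0..1} \<inter> \<rat> \<Longrightarrow> val (Qunit x) = x"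
  by (rule Qunit_inverse)

text \<open>For \<open>p < 1\<close>, increasing points strictly between \<open>p\<close> and 1; the
  summand 2 keeps the point with index 0 off \<open>p\<close>.\<close>

definition ladder :: "real \<Rightarrow> nat \<Rightarrow> real" where
  "ladder p i = 1 - (1 - p) / (real i + 2)"

text \<open>Depth is measured above \<open>p\<close>: for \<open>N = 0\<close> nothing lies between
  \<open>p\<close> and the unit, and an infinite \<open>N\<close> gives infinitely many points
  there.\<close>

definition ladder_carrier :: "real \<Rightarrow> enat \<Rightarrow> real set" where
  "ladder_carrier p N = {0..p} \<inter> \<rat> \<union> {ladder p i | i. enat i < N} \<union> {1}"

definition cut_const :: "real \<Rightarrow> qunit \<Rightarrow> real" where
  "cut_const p q = (if val q \<le> p then val q else 1)"

abbreviation ladder_algebra :: "real \<Rightarrow> enat \<Rightarrow> real rbl" where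
  "ladder_algebra p N \<equiv> chain (ladder_carrier p N) (cut_const p)"

lemma ladder_bounds: "p < 1 \<Longrightarrow> p < ladder p i" "p < 1 \<Longrightarrow> ladder p i < 1"
proof -
  assume "p < 1"
  then have "(1 - p) / (real i + 2) < (1 - p) / 1" by (intro divide_strict_left_mono) auto
  then show "p < ladder p i" by (simp add: ladder_def)
  show "ladder p i < 1" using \<open>p < 1\<close> by (simp add: ladder_def)
qed

lemma ladder_less_iff: "p < 1 \<Longrightarrow> ladder p i < ladder p j \<longleftrightarrow> i < j"
proof -
  assume p: "p < 1"
  have "ladder p i < ladder p j" if "i < j" for i j
    using p that by (simp add: ladder_def) (intro divide_strict_left_mono, auto)
  from this[of i j] this[of j i] show ?thesis by (cases i j rule: linorder_cases) auto
qed

lemma inj_ladder: "p < 1 \<Longrightarrow> inj (ladder p)"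
  by (intro injI) (metis ladder_less_iff linorder_neqE_nat less_irrefl)

lemma ladder_carrier_subset: "0 \<le> p \<Longrightarrow> p < 1 \<Longrightarrow> ladder_carrier p N \<subseteq> {0..1}"
proof -
  assume "0 \<le> p" "p < 1"
  then have "0 \<le> ladder p i \<and> ladder p i \<le> 1" for i using ladder_bounds[of p i] by linarith
  then show ?thesis using \<open>p < 1\<close> by (auto simp: ladder_carrier_def)
qed

lemma rational_goedel_algebra_ladder:
  assumes "0 \<le> p" "p < 1"
  shows "rational_goedel_algebra (ladder_algebra p N)"
proof (rule rational_goedel_algebra_chain)
  show "ladder_carrier p N \<subseteq> {0..1}" using assms by (rule ladder_carrier_subset)
  show "range (cut_const p) \<subseteq> ladder_carrier p N"
    using val_in by (auto simp: cut_const_def ladder_carrier_def)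
qed (use assms val_in(2) in \<open>auto simp: cut_const_def ladder_carrier_def val_qmult val_qimp min_def\<close>)

section \<open>Formulas naming the elements of a ladder\<close>

primrec rung :: "real \<Rightarrow> nat \<Rightarrow> fm" where
  "rung p 0 = cst p"
| "rung p (Suc i) = Or (Imp (Var i) (rung p i)) (Var i)"

text \<open>Since \<open>rung p 0\<close> is the constant for \<open>p\<close>, the ladder point
  with index \<open>i\<close> is named by \<open>rung p (Suc i)\<close>.\<close>

definition ladder_fm :: "real \<Rightarrow> real \<Rightarrow> fm" where
  "ladder_fm p d = (if d \<le> p then cst d else if d = 1 then One else rung p (Suc (inv_into UNIV (ladder p) d)))"

text \<open>The valuation under which the names denote their own elements; past the last ladder
  point the variables get 1.\<close>

definition ladder_val :: "real \<Rightarrow> enat \<Rightarrow> nat \<Rightarrow> real" where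
  "ladder_val p N i = (if enat i < N then ladder p i else 1)"

lemma ladder_carrier_cases [consumes 1, case_names const ladder one]:
  assumes "d \<in> ladder_carrier p N"
  obtains "0 \<le> d" "d \<le> p" "d \<in> \<rat>" | i where "enat i < N" "d = ladder p i" | "d = 1"
  using assms by (auto simp: ladder_carrier_def)

lemma ladder_fm_simps:
  assumes "p < 1"
  shows "ladder_fm p 1 = One" "ladder_fm p (ladder p i) = rung p (Suc i)"
  using assms ladder_bounds[OF assms, of i] inv_into_f_f[OF inj_ladder[OF assms], of i]
  by (auto simp: ladder_fm_def simp del: rung.simps)

lemma eval_ladder_fm:
  assumes p: "p \<in> {0..<1} \<inter> \<rat>" and d: "d \<in> ladder_carrier p N"
  shows "eval (ladder_algebra p N) (ladder_val p N) (ladder_fm p d) = d"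
proof -
  have rung: "eval (ladder_algebra p N) (ladder_val p N) (rung p (Suc i)) = ladder_val p N i" for i
  proof (induction i)
    case 0
    show ?case
      using p ladder_bounds[of p 0] by (auto simp: cst_def cut_const_def ladder_val_def)
  next
    case (Suc i)
    \<comment> \<open>The values increase strictly until they reach 1; in both cases the join
      defining the next rung equals the value of its own variable.\<close>
    have "ladder_val p N i < ladder_val p N (Suc i) \<or>
        ladder_val p N i \<le> 1 \<and> ladder_val p N (Suc i) = 1"
      using p ladder_bounds[of p i] ladder_less_iff[of p i "Suc i"]
        less_trans[of "enat i" "enat (Suc i)" N]
      by (auto simp: ladder_val_def)
    then show ?case using Suc by (subst rung.simps) (auto simp del: rung.simps)
  qed
  have "p < 1" using p by simp
  from d show ?thesis
  proof (cases rule: ladder_carrier_cases)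
    case const
    then show ?thesis using p by (simp add: ladder_fm_def cst_def cut_const_def)
  next
    case (ladder i)
    then show ?thesis
      by (simp add: ladder_fm_simps[OF \<open>p < 1\<close>] rung ladder_val_def del: rung.simps)
  next
    case one
    then show ?thesis by (simp add: ladder_fm_simps[OF \<open>p < 1\<close>])
  qed
qed

text \<open>This makes the ladder projective.\<close>

lemma ladder_fm_heyting_below:
  fixes A :: "('a, 'm) rbl_scheme"
  assumes A: "rational_goedel_algebra A" and w: "range w \<subseteq> carrier A"
    and p: "p \<in> {0..<1} \<inter> \<rat>" and de: "d \<in> ladder_carrier p N" "e \<in> ladder_carrier p N" "d < e"
  shows "heyting_below A (eval A w (ladder_fm p d)) (eval A w (ladder_fm p e))"
proof -
  interpret rational_goedel_algebra A by fact
  note cl = eval_closed[OF A w]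
  have p1: "p < 1" using p by simp
  have step: "heyting_below A (eval A w (rung p i)) (eval A w (rung p (Suc i)))" for i
    using heyting_below_step[OF cl[of "rung p i"] cl[of "Var i"]] by simp
  have rung: "heyting_below A (eval A w (rung p i)) (eval A w (rung p j))" if "i < j" for i j
    using that
  proof (induction rule: less_Suc_induct)
    case (1 i)
    show ?case by (rule step)
  next
    case (2 i j k)
    show ?case by (rule heyting_below_trans[OF cl cl cl 2(3,4)])
  qed
  have below: "heyting_below A (eval A w (cst d)) (eval A w (cst e))"
    if "0 \<le> d" "e \<le> 1" "d \<in> \<rat>" "e \<in> \<rat>" "d < e" for d e
    using that bconst_heyting_below[OF A, of "Qunit d" "Qunit e"] by (simp add: cst_def)
  have "e \<le> 1" using de(2) ladder_carrier_subset[of p N] p by auto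
  then have le1: "d < 1" using de(3) by simp
  from de(2) show ?thesis
  proof (cases rule: ladder_carrier_cases)
    case const
    have "d \<le> p" using const de(3) by simp
    moreover have "0 \<le> d \<and> d \<in> \<rat>"
      using de(1) \<open>d \<le> p\<close> p1 ladder_bounds(1)[OF p1]
      by (cases rule: ladder_carrier_cases) (auto simp: not_less[symmetric])
    ultimately show ?thesis using const below[of d e] de(3) p by (simp add: ladder_fm_def)
  next
    case (ladder j)
    from de(1) show ?thesis
    proof (cases rule: ladder_carrier_cases)
      case const
      have *: "heyting_below A (eval A w (cst p)) (eval A w (rung p (Suc j)))"
        using rung[of 0 "Suc j"] by simp
      have "heyting_below A (eval A w (cst d)) (eval A w (rung p (Suc j)))"
      proof (cases "d = p")
        case False
        then have "heyting_below A (eval A w (cst d)) (eval A w (cst p))"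
          using const p by (intro below) auto
        then show ?thesis by (rule heyting_below_trans[OF cl cl cl _ *])
      qed (use * in simp)
      then show ?thesis using const ladder by (simp add: ladder_fm_simps[OF p1]) (simp add: ladder_fm_def)
    next
      case (ladder i)
      then have "i < j" using de(3) \<open>e = ladder p j\<close> ladder_less_iff[OF p1] by simp
      then show ?thesis using rung[of "Suc i" "Suc j"] ladder \<open>e = ladder p j\<close>
        by (simp add: ladder_fm_simps[OF p1])
    qed (use le1 in simp)
  next
    case one
    then show ?thesis using heyting_below_one[OF cl] by (simp add: ladder_fm_simps[OF p1])
  qed
qed

text \<open>The ladder sends constants above \<open>p\<close> to 1, whose name is
  \<open>One\<close>; this matches \<open>A\<close> because they are the unit there.\<close>

lemma eval_ladder_fm_cut_const:
  assumes "p < 1" "p < val q \<Longrightarrow> bconst A q = one A"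
  shows "eval A w (ladder_fm p (cut_const p q)) = bconst A q"
  using assms by (auto simp: cut_const_def ladder_fm_def cst_def val_inverse)

text \<open>The unifying substitution sends each variable to the formula naming its value.\<close>

lemma not_admissible_ladder:
  assumes p: "p \<in> {0..<1} \<inter> \<rat>" and \<Sigma>: "models (ladder_algebra p N) \<Sigma>"
    and V: "0 \<in> V" "1 \<in> V" and h: "strict_mono_on V h" "h ` V \<subseteq> ladder_carrier p N" "h 0 = 0" "h 1 = 1"
    and vars: "\<And>\<psi> n. \<psi> \<in> insert \<phi> \<Gamma> \<Longrightarrow> n \<in> vars \<psi> \<Longrightarrow> v n \<in> V"
    and constants: "\<And>\<psi> q. \<psi> \<in> insert \<phi> \<Gamma> \<Longrightarrow> q \<in> constants \<psi> \<Longrightarrow>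
      k q \<in> V \<and> h (k q) = cut_const p q \<and> (p < val q \<longrightarrow> Const q \<in> \<Sigma>)"
    and \<Gamma>: "finite \<Gamma>" "\<And>\<gamma>. \<gamma> \<in> \<Gamma> \<Longrightarrow> eval (chain C k) v \<gamma> = 1" and \<phi>: "eval (chain C k) v \<phi> < 1"
  shows "\<not> admissible (add_axioms RG \<Sigma>) \<Gamma> \<phi>"
proof -
  have p1: "p < 1" "0 \<le> p" using p by auto
  define \<sigma> where "\<sigma> n = ladder_fm p (h (v n))" for n
  \<comment> \<open>By \<open>ladder_fm_heyting_below\<close>, \<open>h\<close> followed by naming
    and evaluation in \<open>A\<close> is a homomorphism on \<open>V\<close>. Hence \<sigma> mirrors
    the evaluation of \<psi> in every algebra where the constants of \<psi> above \<open>p\<close>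
    are the unit.\<close>
  have hom: "eval (chain C k) v \<psi> \<in> V \<and>
      eval A w (ladder_fm p (h (eval (chain C k) v \<psi>))) = eval A w (subst \<sigma> \<psi>)"
    if A: "rational_goedel_algebra A" and w: "range w \<subseteq> carrier A" and \<psi>: "\<psi> \<in> insert \<phi> \<Gamma>"
      and one: "\<And>q. q \<in> constants \<psi> \<Longrightarrow> p < val q \<Longrightarrow> bconst A q = one A"
    for A :: "real rbl" and w \<psi>
    unfolding eval_subst
  proof (rule chain_hom[where F = "\<lambda>x. eval A w (ladder_fm p (h x))"])
    interpret rational_goedel_algebra A by fact
    show "goedel_algebra A" by (rule goedel_algebra_axioms)
    show "(\<lambda>x. eval A w (ladder_fm p (h x))) ` V \<subseteq> carrier A" using eval_closed[OF A w] by auto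
    show "eval A w (ladder_fm p (h 0)) = bzero A" "eval A w (ladder_fm p (h 1)) = \<one>\<^bsub>A\<^esub>"
      using p1 by (simp_all add: h ladder_fm_simps) (simp add: ladder_fm_def cst_def const_zero)
    show "heyting_below A (eval A w (ladder_fm p (h x))) (eval A w (ladder_fm p (h y)))"
      if "x \<in> V" "y \<in> V" "x < y" for x y
      using h(2) that strict_mono_onD[OF h(1) that]
      by (intro ladder_fm_heyting_below[OF A w p]) auto
    show "k q \<in> V \<and> eval A w (ladder_fm p (h (k q))) = bconst A q" if "q \<in> constants \<psi>" for q
      using constants[OF \<psi> that] eval_ladder_fm_cut_const[of p q A w, OF p1(1)] one[OF that] by simp
  qed (use V vars[OF \<psi>] in \<open>simp_all add: \<sigma>_def\<close>)
  have "add_axioms RG \<Sigma> {} (subst \<sigma> \<gamma>)" if "\<gamma> \<in> \<Gamma>" for \<gamma>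
  proof (rule add_axioms_RGI)
    \<comment> \<open>The finitely many axioms that \<open>hom\<close> relies on; the identity
      substitution exhibits them as instances.\<close>
    let ?\<Delta> = "Const ` {q \<in> constants \<gamma>. p < val q}"
    show "finite ?\<Delta>" by simp
    have "Const q = subst Var (Const q)" for q by simp
    then show "?\<Delta> \<subseteq> {} \<union> instances \<Sigma>"
      using constants[of \<gamma>] that unfolding instances_def by blast
    show "rga_entails ?\<Delta> (subst \<sigma> \<gamma>)"
      unfolding rga_entails_def
    proof (intro allI impI, elim conjE)
      fix A :: "real rbl" and w
      assume A: "rational_goedel_algebra A" "range w \<subseteq> carrier A"
        and "\<forall>\<delta>\<in>?\<Delta>. eval A w \<delta> = one A"
      then show "eval A w (subst \<sigma> \<gamma>) = one A"
        using hom[OF A, of \<gamma>] that by (simp add: \<Gamma>(2) h ladder_fm_simps[OF p1(1)])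
    qed
  qed
  moreover have "\<not> add_axioms RG \<Sigma> {} (subst \<sigma> \<phi>)"
  proof
    \<comment> \<open>In the ladder itself names denote their elements, so the substituted \<phi>
      takes the value \<open>h ?e\<close>, which is below 1 as \<open>?e\<close> is.\<close>
    let ?M = "ladder_algebra p N" and ?e = "eval (chain C k) v \<phi>"
    assume "add_axioms RG \<Sigma> {} (subst \<sigma> \<phi>)"
    moreover have M: "rational_goedel_algebra ?M" using p1 by (simp add: rational_goedel_algebra_ladder)
    moreover have w: "range (ladder_val p N) \<subseteq> carrier ?M"
      by (auto simp: ladder_val_def ladder_carrier_def)
    ultimately have "eval ?M (ladder_val p N) (subst \<sigma> \<phi>) = 1"
      using add_axioms_RG_sound[OF _ M w \<Sigma>] by simp
    moreover have e: "?e \<in> V" "eval ?M (ladder_val p N) (ladder_fm p (h ?e)) = eval ?M (ladder_val p N) (subst \<sigma> \<phi>)"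
      using hom[OF M w, of \<phi>] by (simp_all add: cut_const_def)
    ultimately have "h ?e = 1" using h(2) eval_ladder_fm[OF p, of "h ?e" N] by auto
    then show False using strict_mono_onD[OF h(1) e(1) V(2) \<phi>] h(4) by simp
  qed
  ultimately show ?thesis by (auto simp: admissible_def)
qed

section \<open>Order-preserving maps of finite sets into the rationals\<close>

lemma strict_mono_on_extend_rational:
  fixes t :: real and h0 :: "real \<Rightarrow> real"
  assumes "finite V" "finite P" "strict_mono_on P h0" "h0 ` P \<subseteq> {..<t} \<inter> \<rat>"
  shows "\<exists>h. strict_mono_on (P \<union> V) h \<and> (\<forall>x\<in>P. h x = h0 x) \<and> h ` (P \<union> V) \<subseteq> {..<t} \<inter> \<rat>"
  using assms(1)
proof induction
  case empty
  then show ?case using assms by auto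
next
  case (insert x V)
  then obtain h where h: "strict_mono_on (P \<union> V) h" "\<forall>x\<in>P. h x = h0 x"
      "h ` (P \<union> V) \<subseteq> {..<t} \<inter> \<rat>" by auto
  show ?case
  proof (cases "x \<in> P")
    case True
    then show ?thesis using h by (intro exI[of _ h]) (auto simp: insert_absorb)
  next
    case False
    \<comment> \<open>The value for \<open>x\<close> must lie between \<open>lo\<close> and
      \<open>hi\<close>; density of the rationals supplies it. Putting \<open>t\<close> into
      \<open>hi\<close> enforces the bound and makes \<open>hi\<close> nonempty, whereas
      \<open>lo\<close> can be empty.\<close>
    define lo where "lo = h ` {y \<in> P \<union> V. y < x}"
    define hi where "hi = insert t (h ` {y \<in> P \<union> V. x < y})"
    have fin: "finite lo" "finite hi" "hi \<noteq> {}"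
      using insert.hyps(1) assms(2) by (auto simp: lo_def hi_def)
    have less: "l < u" if "l \<in> lo" "u \<in> hi" for l u
      using that h(3) by (auto simp: lo_def hi_def intro!: strict_mono_onD[OF h(1)])
    have "\<exists>c\<in>\<rat>. (\<forall>l\<in>lo. l < c) \<and> (\<forall>u\<in>hi. c < u)"
    proof (cases "lo = {}")
      case True
      obtain c where "c \<in> \<rat>" "c < Min hi" using Rats_dense_in_real[of "Min hi - 1" "Min hi"] by auto
      then show ?thesis using True fin by auto
    next
      case False
      have "Max lo < Min hi" using less fin False by simp
      then obtain c where "c \<in> \<rat>" "Max lo < c" "c < Min hi" using Rats_dense_in_real by blast
      then show ?thesis using False fin by auto
    qed
    then obtain c where c: "c \<in> \<rat>" "\<And>l. l \<in> lo \<Longrightarrow> l < c" "\<And>u. u \<in> hi \<Longrightarrow> c < u" by blast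
    have "strict_mono_on (P \<union> insert x V) (h(x := c))"
    proof (rule strict_mono_onI)
      fix y z assume yz: "y \<in> P \<union> insert x V" "z \<in> P \<union> insert x V" "y < z"
      then consider "y = x" "z \<in> P \<union> V" "z \<noteq> x" | "z = x" "y \<in> P \<union> V" "y \<noteq> x"
        | "y \<in> P \<union> V" "z \<in> P \<union> V" "y \<noteq> x" "z \<noteq> x" by auto
      then show "(h(x := c)) y < (h(x := c)) z"
        using yz(3) c(2)[of "h y"] c(3)[of "h z"]
        by cases (auto simp: lo_def hi_def intro: strict_mono_onD[OF h(1)])
    qed
    moreover have "\<forall>y\<in>P. (h(x := c)) y = h0 y" using h(2) False by auto
    moreover have "(h(x := c)) ` (P \<union> insert x V) \<subseteq> {..<t} \<inter> \<rat>"
      using h(3) c(1) c(3)[of t] by (auto simp: hi_def)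
    ultimately show ?thesis by blast
  qed
qed

text \<open>Used to turn the finitely many values of a countermodel into constants: interpreted
  constants return to their own rationals, and density places the other values among them.\<close>

lemma rational_interpolation:
  fixes k :: "qunit \<Rightarrow> real"
  assumes fin: "finite V" "finite K"
    and k: "\<And>p q. p \<in> K \<Longrightarrow> q \<in> K \<Longrightarrow> val p < val q \<Longrightarrow> k p < k q" "\<And>q. q \<in> K \<Longrightarrow> val q < t"
    and V: "k ` K \<subseteq> V" "Qunit 0 \<in> K" "\<And>x. x \<in> V \<Longrightarrow> k (Qunit 0) \<le> x"
  obtains h where "strict_mono_on V h" "\<And>q. q \<in> K \<Longrightarrow> h (k q) = val q" "h ` V \<subseteq> {0..<t} \<inter> \<rat>"
proof -
  have less: "val p < val q" if "p \<in> K" "q \<in> K" "k p < k q" for p q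
    using k(1)[of q p] that by (metis less_asym linorder_neqE_linordered_idom less_irrefl val_inject)
  have inj: "inj_on k K"
    by (intro inj_onI) (metis k(1) linorder_neqE_linordered_idom less_irrefl val_inject)
  define h0 where "h0 = val \<circ> inv_into K k"
  have h0: "h0 (k q) = val q" if "q \<in> K" for q using inj that by (simp add: h0_def)
  have "strict_mono_on (k ` K) h0" using less h0 by (auto intro!: strict_mono_onI)
  moreover have "h0 ` k ` K \<subseteq> {..<t} \<inter> \<rat>" using h0 k(2) val_in(3) by auto
  ultimately obtain h where h: "strict_mono_on V h" "\<forall>x\<in>k ` K. h x = h0 x" "h ` V \<subseteq> {..<t} \<inter> \<rat>"
    using strict_mono_on_extend_rational[OF fin(1), of "k ` K" h0 t] fin(2) V(1)
    by (auto simp: Un_absorb1)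
  have "0 \<le> h x" if "x \<in> V" for x
  proof -
    \<comment> \<open>The constant 0 is interpreted by a lower bound of \<open>V\<close>, so its
      image 0 bounds all images from below.\<close>
    have "h (k (Qunit 0)) = 0" using h(2) h0 V(2) by simp
    then show ?thesis
      using strict_mono_onD[OF h(1), of "k (Qunit 0)" x] V that by fastforce
  qed
  then show thesis using that[of h] h h0 by fastforce
qed


section \<open>Admissible rules\<close>

text \<open>A countermodel of \<psi> satisfying the disjunction interprets the constant for
  \<open>p\<close> as the unit. Its evaluation of \<psi> is matched with a collapse of the ladder
  with \<open>N = 0\<close>. There that constant is below the unit, so soundness makes \<psi> the
  unit, and no collapse can refute it.\<close>

lemma disjunction_rule_admissible:
  assumes p: "p \<in> {0..<1} \<inter> \<rat>" and \<Sigma>: "models (ladder_algebra p 0) \<Sigma>"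
    and deriv: "add_axioms RG \<Sigma> {} (Or (cst p) \<psi>)"
  shows "add_axioms RG \<Sigma> {} \<psi>"
proof (rule ccontr)
  assume not: "\<not> add_axioms RG \<Sigma> {} \<psi>"
  have p1: "0 \<le> p" "p < 1" using p by auto
  obtain \<Delta> where \<Delta>: "finite \<Delta>" "\<Delta> \<subseteq> instances \<Sigma>" "rga_entails \<Delta> (Or (cst p) \<psi>)"
    using deriv unfolding add_axioms_instances RG_def by auto
  have "\<not> rga_entails {Or (cst p) \<psi>} \<psi>"
  proof
    assume "rga_entails {Or (cst p) \<psi>} \<psi>"
    then have "rga_entails \<Delta> \<psi>" using \<Delta>(3) unfolding rga_entails_def by blast
    then show False using not add_axioms_RGI[of \<Delta> "{}" \<Sigma> \<psi>] \<Delta> by auto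
  qed
  define K where "K = insert (Qunit 0) (insert (Qunit p) (constants \<psi>))"
  have K: "finite K" "Qunit 0 \<in> K" "Qunit p \<in> K" "constants \<psi> \<subseteq> K" by (auto simp: K_def)
  obtain k v where pv: "partial_valuation K k v"
      and ev: "eval (chain {0..1} k) v (Or (cst p) \<psi>) = 1" "eval (chain {0..1} k) v \<psi> < 1"
    using chain_countermodel[OF _ K(1) \<open>\<not> rga_entails {Or (cst p) \<psi>} \<psi>\<close>] by auto
  note kv = partial_valuationD[OF pv]
  have kp: "k (Qunit p) = 1" using ev by (auto simp: cst_def max_def split: if_splits)
  \<comment> \<open>The least constant of \<open>K\<close> identified with the unit: positive
    because 0 goes to 0, at most \<open>p\<close> because \<open>p\<close> goes to 1.\<close>
  define t where "t = Min (val ` {q \<in> K. k q = 1})"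
  have fin: "finite (val ` {q \<in> K. k q = 1})" using K(1) by simp
  have ne: "val ` {q \<in> K. k q = 1} \<noteq> {}" using K(3) kp by blast
  obtain q\<^sub>t where qt: "q\<^sub>t \<in> K" "k q\<^sub>t = 1" "t = val q\<^sub>t"
    using Min_in[OF fin ne] by (auto simp: t_def)
  have t_le: "t \<le> val q" if "q \<in> K" "k q = 1" for q
    using fin that by (auto simp: t_def)
  have t_gr: "val q < t" if "q \<in> K" "k q < 1" for q
    using kv(5)[OF qt(1) that(1)] qt that by (metis less_irrefl linorder_neqE_linordered_idom val_inject less_asym)
  have "0 < t" using t_gr[OF K(2)] kv(3) by simp
  have "t \<le> p" using t_le[OF K(3) kp] p by simp
  define V where "V = insert 0 (k ` K \<union> v ` vars \<psi>) - {1}"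
  have V: "finite V" "V \<subseteq> {0..<1}" using K(1) kv(1,2) by (auto simp: V_def less_le)
  obtain h0 where h0: "strict_mono_on V h0" "\<And>q. q \<in> {q \<in> K. k q < 1} \<Longrightarrow> h0 (k q) = val q"
      "h0 ` V \<subseteq> {0..<t} \<inter> \<rat>"
  proof (rule rational_interpolation[of V "{q \<in> K. k q < 1}" k t])
    show "k p < k q" if "p \<in> {q \<in> K. k q < 1}" "q \<in> {q \<in> K. k q < 1}" "val p < val q" for p q
      using kv(5)[of p q] that by auto
  qed (use V K kv(3) t_gr in \<open>auto simp: V_def\<close>)
  define h where "h x = (if x = 1 then 1 else h0 x)" for x
  have h0_bound: "0 \<le> h0 x" "h0 x < t" "h0 x \<in> \<rat>" if "x \<in> V" for x using h0(3) that by auto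
  have "h 0 = 0" using h0(2)[of "Qunit 0"] K(2) kv(3) by (simp add: h_def)
  define w where "w n = (if n \<in> vars \<psi> then h (v n) else 1)" for n
  define e where "e = eval (ladder_algebra p 0) w \<psi>"
  have hV: "h x \<in> ladder_carrier p 0" "collapse t (h x) = h x" if "x \<in> insert 1 V" for x
    using h0_bound[of x] that \<open>t \<le> p\<close> p1
    by (auto simp: h_def ladder_carrier_def collapse_def)
  have vV: "v n \<in> insert 1 V" if "n \<in> vars \<psi>" for n using that by (auto simp: V_def)
  have M: "rational_goedel_algebra (ladder_algebra p 0)"
    using p1 by (rule rational_goedel_algebra_ladder)
  \<comment> \<open>By soundness; since the first disjunct has the value \<open>p < 1\<close>,
    \<psi> itself takes the value 1.\<close>
  have "eval (ladder_algebra p 0) w (Or (cst p) \<psi>) = 1"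
    using add_axioms_RG_sound[OF deriv M _ \<Sigma>, of w] hV(1)[OF vV]
    by (force simp: w_def ladder_carrier_def)
  then have e: "e = 1" using p1 p by (auto simp: e_def cst_def cut_const_def max_def split: if_splits)
  let ?A = "chain {0..1} (collapse t \<circ> cut_const p)"
  have A: "goedel_algebra ?A" by (rule goedel_algebra_chain) auto
  have sub: "ladder_carrier p 0 \<subseteq> {0..1}" using p1 by (rule ladder_carrier_subset)
  interpret M: rational_goedel_algebra "ladder_algebra p 0" by (rule M)
  \<comment> \<open>Two homomorphisms into \<open>?A\<close> are compared: the collapse of the
    ladder, which fixes the values of \<open>w\<close>, and \<open>h\<close> from the countermodel.
    Both send the value of \<psi> to its value under \<open>w\<close>, so \<open>h0\<close> would
    have to reach 1 although it stays below \<open>t\<close>.\<close>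
  have "collapse t e = eval ?A w \<psi>"
    unfolding e_def
  proof (rule chain_hom[where D = "ladder_carrier p 0", THEN conjunct2, OF A])
    show "cut_const p q \<in> ladder_carrier p 0 \<and> collapse t (cut_const p q) = bconst ?A q" for q
      using M.const_closed[of q] by simp
    show "collapse t ` ladder_carrier p 0 \<subseteq> carrier ?A"
      using sub by (auto simp: collapse_def)
    show "w n \<in> ladder_carrier p 0 \<and> collapse t (w n) = w n" if "n \<in> vars \<psi>" for n
      using that hV vV by (simp add: w_def)
    show "heyting_below ?A (collapse t d) (collapse t e)"
      if "d \<in> ladder_carrier p 0" "e \<in> ladder_carrier p 0" "d < e" for d e
      using that sub by (auto simp: heyting_below_chain collapse_def)
  qed (use M.zero_closed M.one_closed \<open>0 < t\<close> \<open>t \<le> p\<close> p1 in \<open>simp_all add: collapse_def\<close>)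
  moreover have "eval (chain {0..1} k) v \<psi> \<in> insert 1 V \<and> h (eval (chain {0..1} k) v \<psi>) = eval ?A w \<psi>"
  proof (rule chain_hom[OF A])
    show "0 \<in> insert 1 V" by (simp add: V_def)
    have "h x \<in> {0..1}" if "x \<in> insert 1 V" for x using hV(1)[OF that] sub by blast
    then show "h ` insert 1 V \<subseteq> carrier ?A" by (simp add: image_subset_iff)
    show "heyting_below ?A (h d) (h e)" if "d \<in> insert 1 V" "e \<in> insert 1 V" "d < e" for d e
      using that V(2) h0_bound[of d] \<open>t \<le> p\<close> p1 strict_mono_onD[OF h0(1), of d e]
      by (auto simp: heyting_below_chain h_def)
    show "v n \<in> insert 1 V \<and> h (v n) = w n" if "n \<in> vars \<psi>" for n
      using that vV by (simp add: w_def)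
    show "k q \<in> insert 1 V \<and> h (k q) = bconst ?A q" if "q \<in> constants \<psi>" for q
    proof -
      have q: "q \<in> K" using that K(4) by blast
      show ?thesis
      proof (cases "k q = 1")
        case True
        then show ?thesis using t_le[OF q] \<open>t \<le> p\<close> p1
          by (auto simp: h_def cut_const_def collapse_def)
      next
        case False
        then have "k q < 1" using kv(2)[of q] by simp
        then show ?thesis using t_gr[OF q] h0(2)[of q] q False \<open>t \<le> p\<close>
          by (auto simp: V_def h_def cut_const_def collapse_def)
      qed
    qed
  qed (use \<open>h 0 = 0\<close> in \<open>simp_all add: h_def\<close>)
  ultimately have "eval (chain {0..1} k) v \<psi> \<in> V" "h0 (eval (chain {0..1} k) v \<psi>) = 1"
    using ev(2) e \<open>t \<le> p\<close> p1 by (auto simp: h_def collapse_def)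
  then show False using h0_bound(2) \<open>t \<le> p\<close> p1 by fastforce
qed

text \<open>If the disjunction of the constant and \<phi> were derivable, the rule would yield
  \<phi>. So the disjunction is refutable, and a countermodel of it keeps that constant, hence every
  smaller one in \<open>K\<close>, below the unit.\<close>

lemma disjunction_rule_countermodel:
  assumes rule: "({Or (cst q) (Var z)}, Var z) \<in> R"
    and not: "\<not> add_rules (add_axioms RG \<Sigma>) R \<Gamma> \<phi>"
    and fin: "finite \<Gamma>" "finite \<Delta>" "finite K" and \<Delta>: "\<Delta> \<subseteq> instances \<Sigma>" and K: "Qunit q \<in> K"
  obtains k v where "partial_valuation K k v"
    "\<forall>\<delta>\<in>\<Gamma> \<union> \<Delta>. eval (chain {0..1} k) v \<delta> = 1" "eval (chain {0..1} k) v \<phi> < 1"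
    "\<forall>q'\<in>K. val q' \<le> val (Qunit q) \<longrightarrow> k q' < 1"
proof -
  have "\<not> rga_entails (\<Gamma> \<union> \<Delta>) (Or (cst q) \<phi>)"
  proof
    assume "rga_entails (\<Gamma> \<union> \<Delta>) (Or (cst q) \<phi>)"
    then have "add_axioms RG \<Sigma> \<Gamma> (Or (cst q) \<phi>)"
      using add_axioms_RGI[of "\<Gamma> \<union> \<Delta>" \<Gamma> \<Sigma>] fin \<Delta> by blast
    then have "add_rules (add_axioms RG \<Sigma>) R \<Gamma> (Or (cst q) \<phi>)"
      by (rule add_rules.base) (rule add_rules.hyp)
    then have "add_rules (add_axioms RG \<Sigma>) R \<Gamma> (subst (\<lambda>_. \<phi>) (Var z))"
      by (intro add_rules.rule[OF rule]) (simp add: cst_def)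
    then show False using not by simp
  qed
  then obtain k v where pv: "partial_valuation K k v"
      and ev: "\<forall>\<delta>\<in>\<Gamma> \<union> \<Delta>. eval (chain {0..1} k) v \<delta> = 1"
      "eval (chain {0..1} k) v (Or (cst q) \<phi>) < 1"
    using chain_countermodel[OF _ fin(3)] fin(1,2) by (metis finite_Un)
  have "k q' < 1" if "q' \<in> K" "val q' \<le> val (Qunit q)" for q'
  proof (cases "val q' = val (Qunit q)")
    case True
    then show ?thesis using ev(2) by (simp add: cst_def val_inject)
  next
    case False
    then show ?thesis using partial_valuationD(5)[OF pv that(1) K] ev(2) that(2) by (auto simp: cst_def)
  qed
  then show thesis using that[OF pv ev(1)] ev(2) by simp
qed

section \<open>Base for the logics with all constants from \<open>r\<close> on\<close>

lemma admissible_base_RG_lower: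
  assumes r: "r \<in> {0<..1}"
  shows "admissible_base (RG_lower r) {({Or (cst q) (Var z)}, Var z) | q. q \<in> {0..<r} \<inter> \<rat>}"
    (is "admissible_base _ ?R")
proof -
  define \<Sigma> where "\<Sigma> = {cst q | q. q \<in> {r..1} \<inter> \<rat>}"
  have L: "RG_lower r = add_axioms RG \<Sigma>" by (simp add: RG_lower_def \<Sigma>_def)
  have in_\<Sigma>: "Const q \<in> \<Sigma>" if "r \<le> val q" for q
    using that val_in[of q] unfolding \<Sigma>_def by (auto intro!: exI[of _ "val q"])
  have models: "models (ladder_algebra q 0) \<Sigma>" if "q < r" for q
    using that r by (auto simp: models_def \<Sigma>_def cst_def cut_const_def)
  show ?thesis
    unfolding L
  proof (rule admissible_baseI)
    show "is_logic (add_axioms RG \<Sigma>)" by (intro is_logic_add_axioms is_logic_RG)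
    show "finite \<Delta> \<and> admissible (add_axioms RG \<Sigma>) \<Delta> \<psi>" if R: "(\<Delta>, \<psi>) \<in> ?R" for \<Delta> \<psi>
    proof -
      obtain q where q: "\<Delta> = {Or (cst q) (Var z)}" "\<psi> = Var z" "q \<in> {0..<r} \<inter> \<rat>"
        using R by blast
      have "add_axioms RG \<Sigma> {} (\<sigma> z)" if "add_axioms RG \<Sigma> {} (Or (cst q) (\<sigma> z))" for \<sigma>
        using disjunction_rule_admissible[OF _ models that] q(3) r by auto
      then show ?thesis using q(1,2) by (simp add: admissible_def cst_def)
    qed
    fix \<Gamma> \<phi> assume \<Gamma>: "finite \<Gamma>" and not: "\<not> add_rules (add_axioms RG \<Sigma>) ?R \<Gamma> \<phi>"
    define K\<^sub>0 where "K\<^sub>0 = insert (Qunit 0) (\<Union>\<gamma>\<in>insert \<phi> \<Gamma>. constants \<gamma>)"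
    \<comment> \<open>The largest occurring constant below \<open>r\<close>; including 0 guarantees
      one. The rule for it alone keeps every occurring constant below \<open>r\<close> away from the
      unit.\<close>
    define q\<^sub>0 where "q\<^sub>0 = Max (val ` {q \<in> K\<^sub>0. val q < r})"
    have fin: "finite K\<^sub>0" using \<Gamma> by (simp add: K\<^sub>0_def)
    have 0: "Qunit 0 \<in> {q \<in> K\<^sub>0. val q < r}" using r by (simp add: K\<^sub>0_def)
    have "q\<^sub>0 \<in> val ` {q \<in> K\<^sub>0. val q < r}" using fin 0 unfolding q\<^sub>0_def by (intro Max_in) auto
    then obtain c where c: "c \<in> K\<^sub>0" "val c < r" "q\<^sub>0 = val c" by auto
    have le_q0: "val q \<le> q\<^sub>0" if "q \<in> K\<^sub>0" "val q < r" for q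
      using fin that by (auto simp: q\<^sub>0_def)
    \<comment> \<open>A rational cut with room above the occurring constants below \<open>r\<close>.
      None of \<open>K\<^sub>0\<close> lies between it and \<open>r\<close>, so those above it are
      axioms.\<close>
    obtain q\<^sub>1 where q1: "q\<^sub>1 \<in> \<rat>" "q\<^sub>0 < q\<^sub>1" "q\<^sub>1 < r" using Rats_dense_in_real[of q\<^sub>0 r] c by auto
    have q1': "q\<^sub>1 \<in> {0..<1} \<inter> \<rat>" using q1 c r val_in(1)[of c] by auto
    let ?\<Delta> = "Const ` {q \<in> K\<^sub>0. r \<le> val q}"
    have "q\<^sub>0 \<in> {0..<r} \<inter> \<rat>" using c val_in[of c] by simp
    then have rule: "({Or (cst q\<^sub>0) (Var z)}, Var z) \<in> ?R" by blast
    have "Const q = subst Var (Const q)" for q by simp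
    then have \<Delta>: "?\<Delta> \<subseteq> instances \<Sigma>" using in_\<Sigma> unfolding instances_def by blast
    have "finite ?\<Delta>" using fin by simp
    have "Qunit q\<^sub>0 \<in> K\<^sub>0" using c by (simp add: val_inverse)
    obtain k v where pv: "partial_valuation K\<^sub>0 k v"
        and ev: "\<forall>\<delta>\<in>\<Gamma> \<union> ?\<Delta>. eval (chain {0..1} k) v \<delta> = 1" "eval (chain {0..1} k) v \<phi> < 1"
        "\<forall>q'\<in>K\<^sub>0. val q' \<le> val (Qunit q\<^sub>0) \<longrightarrow> k q' < 1"
      by (rule disjunction_rule_countermodel[OF rule not \<Gamma> \<open>finite ?\<Delta>\<close> fin \<Delta> \<open>Qunit q\<^sub>0 \<in> K\<^sub>0\<close>])
    note kv = partial_valuationD[OF pv]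
    have small: "k q < 1" if "q \<in> K\<^sub>0" "val q < r" for q
      using ev(3) that(1) le_q0[OF that] c by (simp add: val_inverse)
    have large: "k q = 1" if "q \<in> K\<^sub>0" "r \<le> val q" for q
      using ev(1)[rule_format, of "Const q"] that by auto
    define V where "V = insert 0 (k ` K\<^sub>0 \<union> v ` (\<Union>\<gamma>\<in>insert \<phi> \<Gamma>. vars \<gamma>)) - {1}"
    have V: "finite V" "V \<subseteq> {0..<1}" using fin \<Gamma> kv(1,2) by (auto simp: V_def less_le)
    obtain h where h: "strict_mono_on V h" "\<And>q. q \<in> {q \<in> K\<^sub>0. val q < r} \<Longrightarrow> h (k q) = val q"
        "h ` V \<subseteq> {0..<q\<^sub>1} \<inter> \<rat>"
    proof (rule rational_interpolation[of V "{q \<in> K\<^sub>0. val q < r}" k q\<^sub>1])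
      show "k p < k q" if "p \<in> {q \<in> K\<^sub>0. val q < r}" "q \<in> {q \<in> K\<^sub>0. val q < r}" "val p < val q" for p q
        using kv(5)[of p q] small[of q] that by auto
      show "val q < q\<^sub>1" if "q \<in> {q \<in> K\<^sub>0. val q < r}" for q
        using le_q0[of q] q1(2) that by auto
      show "k ` {q \<in> K\<^sub>0. val q < r} \<subseteq> V" using small by (fastforce simp: V_def)
    qed (use V fin 0 kv(3) in auto)
    \<comment> \<open>No ladder points are needed: infinitely many constants lie between
      \<open>q\<^sub>0\<close> and the cut, so all values below 1 become constants.\<close>
    show "\<not> admissible (add_axioms RG \<Sigma>) \<Gamma> \<phi>"
    proof (rule not_admissible_ladder[of q\<^sub>1 0 \<Sigma> "insert 1 V" "\<lambda>x. if x = 1 then 1 else h x" \<phi> \<Gamma> v k])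
      have hV: "0 \<le> h x" "h x < q\<^sub>1" "h x \<in> \<rat>" if "x \<in> V" for x using h(3) that by auto
      show "strict_mono_on (insert 1 V) (\<lambda>x. if x = 1 then 1 else h x)"
      proof (rule strict_mono_onI)
        fix x y assume "x \<in> insert 1 V" "y \<in> insert 1 V" "x < y"
        then show "(if x = 1 then 1 else h x) < (if y = 1 then 1 else h y)"
          using V(2) hV(2)[of x] q1' strict_mono_onD[OF h(1), of x y] by auto
      qed
      show "(\<lambda>x. if x = 1 then 1 else h x) ` insert 1 V \<subseteq> ladder_carrier q\<^sub>1 0"
        using hV by (auto simp: ladder_carrier_def less_imp_le)
      show "(if 0 = (1 :: real) then 1 else h 0) = 0" using h(2)[OF 0] kv(3) r by simp
      show "v n \<in> insert 1 V" if "\<psi> \<in> insert \<phi> \<Gamma>" "n \<in> vars \<psi>" for \<psi> n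
        using that by (auto simp: V_def)
      show "k q \<in> insert 1 V \<and> (if k q = 1 then 1 else h (k q)) = cut_const q\<^sub>1 q \<and>
          (q\<^sub>1 < val q \<longrightarrow> Const q \<in> \<Sigma>)" if "\<psi> \<in> insert \<phi> \<Gamma>" "q \<in> constants \<psi>" for \<psi> q
      proof -
        have q: "q \<in> K\<^sub>0" using that by (auto simp: K\<^sub>0_def)
        show ?thesis
        proof (cases "val q < r")
          case True
          then show ?thesis using q h(2)[of q] small[OF q] le_q0[OF q] q1
            by (auto simp: V_def cut_const_def)
        next
          case False
          then show ?thesis using q large[OF q] in_\<Sigma> q1 by (auto simp: cut_const_def)
        qed
      qed
    qed (use q1' q1 models V \<Gamma> ev(1,2) in \<open>auto simp: V_def\<close>)
  qed
qed


section \<open>Bounded depth\<close>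

lemma eval_big_or_chain:
  assumes "\<And>\<phi>. \<phi> \<in> set \<phi>s \<Longrightarrow> eval (chain C k) v \<phi> \<le> 1"
  shows "eval (chain C k) v (big_or \<phi>s) = 1 \<longleftrightarrow> (\<exists>\<phi>\<in>set \<phi>s. eval (chain C k) v \<phi> = 1)"
proof -
  have "eval (chain C k) v (big_or \<phi>s) \<le> 1 \<and>
      (eval (chain C k) v (big_or \<phi>s) = 1 \<longleftrightarrow> (\<exists>\<phi>\<in>set \<phi>s. eval (chain C k) v \<phi> = 1))"
    using assms by (induction \<phi>s rule: big_or.induct) (auto simp: max_def)
  then show ?thesis by blast
qed

text \<open>Over all valuations in a chain this limits the elements from the constant for
  \<open>p\<close> upwards to \<open>n + 2\<close>: that constant, the unit and \<open>n\<close>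
  others.\<close>

lemma eval_bounded_axiom_chain:
  assumes "\<And>n. v n \<in> {0..1}" "\<And>q. k q \<in> {0..1}"
  shows "eval (chain C k) v (bounded_axiom p n) = 1 \<longleftrightarrow>
    (\<exists>i j. i < j \<and> j < n + 3 \<and> max (k (Qunit p)) (v i) = max (k (Qunit p)) (v j))"
proof -
  have "eval (chain C k) v \<phi> \<le> 1" for \<phi>
    using eval_chain_closed[of "{0..1}" v k C \<phi>] assms by auto
  then have "eval (chain C k) v (bounded_axiom p n) = 1 \<longleftrightarrow>
    (\<exists>i j. i < j \<and> j < n + 3 \<and> eval (chain C k) v (Iff (Or (cst p) (Var i)) (Or (cst p) (Var j))) = 1)"
    unfolding bounded_axiom_def by (subst eval_big_or_chain) (fastforce simp: Suc_le_eq)+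
  then show ?thesis using eval_Iff_chain[of v k C, OF assms] by (simp add: cst_def)
qed

text \<open>Covers finite and infinite \<gamma> at once, as a single axiomatic extension.\<close>

definition upper_axioms :: "real \<Rightarrow> enat \<Rightarrow> fm set" where
  "upper_axioms p \<gamma> = {cst q | q. q \<in> {p<..1} \<inter> \<rat>} \<union>
     (case \<gamma> of enat n \<Rightarrow> {bounded_axiom p n} | \<infinity> \<Rightarrow> {})"

lemma RG_upper_eq: "RG_upper p \<gamma> = add_axioms RG (upper_axioms p \<gamma>)"
  by (cases \<gamma>) (simp_all add: RG_upper_def RG_omega_def upper_axioms_def add_axioms_add_axioms)

lemma models_upper_axioms:
  assumes p: "p \<in> {0..<1} \<inter> \<rat>" and N: "N \<le> \<gamma>"
  shows "models (ladder_algebra p N) (upper_axioms p \<gamma>)"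
  unfolding models_def
proof (intro ballI allI impI)
  fix s and v :: "nat \<Rightarrow> real"
  assume s: "s \<in> upper_axioms p \<gamma>" and v: "range v \<subseteq> carrier (ladder_algebra p N)"
  have p1: "0 \<le> p" "p < 1" using p by auto
  show "eval (ladder_algebra p N) v s = one (ladder_algebra p N)"
  proof (cases "\<exists>q \<in> {p<..1} \<inter> \<rat>. s = cst q")
    case True
    then show ?thesis using p1 by (auto simp: cst_def cut_const_def)
  next
    case False
    then obtain n where n: "\<gamma> = enat n" "s = bounded_axiom p n"
      using s by (cases \<gamma>) (auto simp: upper_axioms_def)
    \<comment> \<open>Joining with \<open>p\<close> leaves only \<open>p\<close>, 1 and at most the
      first \<open>n\<close> ladder points, so \<open>n + 3\<close> indices cannot have distinct
      values.\<close>
    let ?W = "{p, 1} \<union> ladder p ` {..<n}"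
    have W: "max p (v i) \<in> ?W" for i
    proof -
      have "v i \<in> ladder_carrier p N" using v by auto
      then show ?thesis
      proof (cases rule: ladder_carrier_cases)
        case (ladder j)
        have "enat j < enat n" using ladder(1) N n(1) by (metis order_less_le_trans)
        then show ?thesis using ladder(2) ladder_bounds(1)[OF p1(2), of j] by (auto simp: max_def)
      qed (use p1 in \<open>auto simp: max_def\<close>)
    qed
    have "card ?W \<le> card {p, 1} + card (ladder p ` {..<n})" by (rule card_Un_le)
    also have "\<dots> \<le> 2 + n" using card_image_le[of "{..<n}" "ladder p"]
      by (intro add_mono) (auto simp: card_insert_if)
    finally have "card ?W < card {..<n + 3}" by simp
    then have "\<not> inj_on (\<lambda>i. max p (v i)) {..<n + 3}"
      using card_inj_on_le[of "\<lambda>i. max p (v i)" "{..<n + 3}" ?W] W by force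
    then obtain i j where ij: "i < n + 3" "j < n + 3" "i \<noteq> j" "max p (v i) = max p (v j)"
      by (auto simp: inj_on_def)
    then have "\<exists>i j. i < j \<and> j < n + 3 \<and> max p (v i) = max p (v j)"
      by (metis linorder_neqE_nat)
    moreover have "cut_const p (Qunit p) = p" using p by (simp add: cut_const_def)
    moreover have "v i \<in> {0..1}" "cut_const p q \<in> {0..1}" for i q
      using subsetD[OF ladder_carrier_subset[OF p1, of N], of "v i"] v val_in[of q]
      by (auto simp: cut_const_def image_subset_iff)
    ultimately show ?thesis
      using eval_bounded_axiom_chain[of v "cut_const p" "ladder_carrier p N" p n] n(2) by simp
  qed
qed

text \<open>Letting the \<open>n + 3\<close> variables run through all tuples from \<open>X\<close>
  gives finitely many instances, and by pigeonhole these already bound the number of values; the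
  same \<Delta> serves every chain and valuation.\<close>

lemma bounded_axiom_instances:
  assumes fin: "finite X"
  obtains \<Delta> where "finite \<Delta>" "\<Delta> \<subseteq> instances {bounded_axiom p n}"
    "\<forall>C k v. (\<forall>n. v n \<in> {0..1}) \<and> (\<forall>q. k q \<in> {0..1}) \<and>
       (\<forall>\<delta>\<in>\<Delta>. eval (chain C k) v \<delta> = 1) \<longrightarrow>
       card ((\<lambda>\<phi>. max (k (Qunit p)) (eval (chain C k) v \<phi>)) ` X) \<le> n + 2"
proof -
  \<comment> \<open>Extensional functions keep the set of substitutions finite; their default value
    concerns only variables outside the axiom.\<close>
  let ?\<Delta> = "(\<lambda>\<sigma>. subst \<sigma> (bounded_axiom p n)) ` (PiE {..<n + 3} (\<lambda>_. X))"
  have "finite ?\<Delta>" using fin by (intro finite_imageI finite_PiE) auto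
  moreover have "?\<Delta> \<subseteq> instances {bounded_axiom p n}" by (auto simp: instances_def)
  moreover have "\<forall>C k v. (\<forall>n. v n \<in> {0..1}) \<and> (\<forall>q. k q \<in> {0..1}) \<and>
       (\<forall>\<delta>\<in>?\<Delta>. eval (chain C k) v \<delta> = 1) \<longrightarrow>
       card ((\<lambda>\<phi>. max (k (Qunit p)) (eval (chain C k) v \<phi>)) ` X) \<le> n + 2"
  proof (intro allI impI, elim conjE, rule ccontr)
    fix C :: "real set" and k and v :: "nat \<Rightarrow> real"
    assume v: "\<forall>n. v n \<in> {0..1}" and k: "\<forall>q. k q \<in> {0..1}"
      and \<Delta>: "\<forall>\<delta>\<in>?\<Delta>. eval (chain C k) v \<delta> = 1"
    let ?f = "\<lambda>\<phi>. max (k (Qunit p)) (eval (chain C k) v \<phi>)"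
    assume "\<not> card (?f ` X) \<le> n + 2"
    then have "card {..<n + 3} \<le> card (?f ` X)" by simp
    then obtain g where g: "g ` {..<n + 3} \<subseteq> ?f ` X" "inj_on g {..<n + 3}"
      using fin card_le_inj[of "{..<n + 3}" "?f ` X"] by auto
    then have "\<forall>i\<in>{..<n + 3}. \<exists>\<phi>\<in>X. g i = ?f \<phi>" by blast
    then obtain \<sigma>0 where \<sigma>0: "\<And>i. i < n + 3 \<Longrightarrow> \<sigma>0 i \<in> X \<and> g i = ?f (\<sigma>0 i)"
      by (metis lessThan_iff)
    define \<sigma> where "\<sigma> = restrict \<sigma>0 {..<n + 3}"
    have "\<sigma> \<in> PiE {..<n + 3} (\<lambda>_. X)" using \<sigma>0 by (auto simp: \<sigma>_def)
    then have "eval (chain C k) v (subst \<sigma> (bounded_axiom p n)) = 1" using \<Delta> by blast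
    moreover have "eval (chain C k) v (\<sigma> i) \<in> {0..1}" for i
      by (rule eval_chain_closed) (use v k in auto)
    ultimately obtain i j where "i < j" "j < n + 3" "?f (\<sigma> i) = ?f (\<sigma> j)"
      unfolding eval_subst
      using eval_bounded_axiom_chain[of "\<lambda>i. eval (chain C k) v (\<sigma> i)" k C p n] k by auto
    then have "g i = g j" "i < j" "j < n + 3" using \<sigma>0[of i] \<sigma>0[of j] by (auto simp: \<sigma>_def)
    then show False using g(2) by (auto dest!: inj_onD)
  qed
  ultimately show thesis by (rule that)
qed

lemma upper_axioms_instances:
  assumes "finite X"
  obtains \<Delta> where "finite \<Delta>" "\<Delta> \<subseteq> instances (upper_axioms p \<gamma>)"
    "\<forall>C k v. (\<forall>n. v n \<in> {0..1}) \<and> (\<forall>q. k q \<in> {0..1}) \<and>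
       (\<forall>\<delta>\<in>\<Delta>. eval (chain C k) v \<delta> = 1) \<longrightarrow>
       enat (card ((\<lambda>\<phi>. max (k (Qunit p)) (eval (chain C k) v \<phi>)) ` X)) \<le> \<gamma> + 2"
proof (cases \<gamma>)
  case (enat n)
  obtain \<Delta> where \<Delta>: "finite \<Delta>" "\<Delta> \<subseteq> instances {bounded_axiom p n}"
    "\<forall>C k v. (\<forall>n. v n \<in> {0..1}) \<and> (\<forall>q. k q \<in> {0..1}) \<and>
       (\<forall>\<delta>\<in>\<Delta>. eval (chain C k) v \<delta> = 1) \<longrightarrow>
       card ((\<lambda>\<phi>. max (k (Qunit p)) (eval (chain C k) v \<phi>)) ` X) \<le> n + 2"
    by (rule bounded_axiom_instances[OF assms])
  have "enat n + 2 = enat (n + 2)" by (simp add: numeral_eq_enat)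
  moreover have "\<Delta> \<subseteq> instances (upper_axioms p \<gamma>)"
    using \<Delta>(2) instances_mono[of "{bounded_axiom p n}" "upper_axioms p \<gamma>"] enat
    by (simp add: upper_axioms_def)
  ultimately show thesis using that[of \<Delta>] \<Delta>(1,3) enat by simp
next
  case infinity
  then show thesis using that[of "{}"] by simp
qed

section \<open>Base for the logics with all constants above \<open>p\<close>\<close>

lemma admissible_base_RG_upper:
  assumes p: "p \<in> {0..<1} \<inter> \<rat>"
  shows "admissible_base (RG_upper p \<gamma>) {({Or (cst p) (Var z)}, Var z)}"
    (is "admissible_base _ ?R")
proof -
  define \<Sigma> where "\<Sigma> = upper_axioms p \<gamma>"
  have p1: "0 \<le> p" "p < 1" using p by auto
  have in_\<Sigma>: "Const q \<in> \<Sigma>" if "p < val q" for q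
    using that val_in[of q] unfolding \<Sigma>_def upper_axioms_def by (auto intro!: exI[of _ "val q"])
  have models: "models (ladder_algebra p N) \<Sigma>" if "N \<le> \<gamma>" for N
    using models_upper_axioms[OF p that] by (simp add: \<Sigma>_def)
  show ?thesis
    unfolding RG_upper_eq \<Sigma>_def[symmetric]
  proof (rule admissible_baseI)
    show "is_logic (add_axioms RG \<Sigma>)" by (intro is_logic_add_axioms is_logic_RG)
    show "finite \<Delta> \<and> admissible (add_axioms RG \<Sigma>) \<Delta> \<psi>" if "(\<Delta>, \<psi>) \<in> ?R" for \<Delta> \<psi>
      using that disjunction_rule_admissible[OF p models]
      by (auto simp: admissible_def cst_def)
    fix \<Gamma> \<phi> assume \<Gamma>: "finite \<Gamma>" and not: "\<not> add_rules (add_axioms RG \<Sigma>) ?R \<Gamma> \<phi>"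
    define K where "K = insert (Qunit 0) (insert (Qunit p) (\<Union>\<gamma>\<in>insert \<phi> \<Gamma>. constants \<gamma>))"
    define X where "X = (\<Union>\<gamma>\<in>insert \<phi> \<Gamma>. vars \<gamma>)"
    have fin: "finite K" "finite X" using \<Gamma> by (simp_all add: K_def X_def)
    \<comment> \<open>Formulas whose values will exhaust the part of the countermodel from the
      constant for \<open>p\<close> upwards, where the depth bound applies.\<close>
    define F where "F = {Const (Qunit p), One} \<union> Var ` X"
    have "finite F" using fin by (simp add: F_def)
    then obtain \<Delta> where \<Delta>: "finite \<Delta>" "\<Delta> \<subseteq> instances \<Sigma>"
      "\<forall>C k v. (\<forall>n. v n \<in> {0..1}) \<and> (\<forall>q. k q \<in> {0..1}) \<and>
         (\<forall>\<delta>\<in>\<Delta>. eval (chain C k) v \<delta> = 1) \<longrightarrow>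
         enat (card ((\<lambda>\<phi>. max (k (Qunit p)) (eval (chain C k) v \<phi>)) ` F)) \<le> \<gamma> + 2"
      unfolding \<Sigma>_def by (rule upper_axioms_instances)
    let ?\<Delta> = "\<Delta> \<union> Const ` {q \<in> K. p < val q}"
    have "Const q = subst Var (Const q)" for q by simp
    then have \<Delta>': "?\<Delta> \<subseteq> instances \<Sigma>" using \<Delta>(2) in_\<Sigma> unfolding instances_def by blast
    have Kp: "Qunit p \<in> K" "val (Qunit p) = p" and K0: "Qunit 0 \<in> K" using p by (simp_all add: K_def)
    have "finite ?\<Delta>" using fin(1) \<Delta>(1) by simp
    have rule: "({Or (cst p) (Var z)}, Var z) \<in> ?R" by simp
    obtain k v where pv: "partial_valuation K k v"
        and ev: "\<forall>\<delta>\<in>\<Gamma> \<union> ?\<Delta>. eval (chain {0..1} k) v \<delta> = 1" "eval (chain {0..1} k) v \<phi> < 1"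
        "\<forall>q'\<in>K. val q' \<le> val (Qunit p) \<longrightarrow> k q' < 1"
      by (rule disjunction_rule_countermodel[OF rule not \<Gamma> \<open>finite ?\<Delta>\<close> fin(1) \<Delta>' Kp(1)])
    note kv = partial_valuationD[OF pv]
    define c where "c = k (Qunit p)"
    have c: "c < 1" "0 \<le> c" using ev(3) Kp(1) kv(2)[of "Qunit p"] by (auto simp: c_def)
    have small: "k q \<le> c" if "q \<in> K" "val q \<le> p" for q
      using kv(5)[OF that(1) Kp(1)] that(2) Kp(2) c(1)
      by (cases "val q = p") (auto simp: c_def val_inject[symmetric] val_inverse less_imp_le)
    have large: "k q = 1" if "q \<in> K" "p < val q" for q
      using ev(1)[rule_format, of "Const q"] that by auto
    define V where "V = {0, 1} \<union> k ` K \<union> v ` X"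
    have V: "finite V" "V \<subseteq> {0..1}" using fin kv(1,2) by (auto simp: V_def)
    have "enat (card ((\<lambda>\<phi>. max c (eval (chain {0..1} k) v \<phi>)) ` F)) \<le> \<gamma> + 2"
      unfolding c_def using kv(1,2) ev(1) by (intro \<Delta>(3)[rule_format]) auto
    \<comment> \<open>Occurring constants lie at or below \<open>c\<close> or are 1, so above
      \<open>c\<close> only 1 and values of variables remain, all taken by members of
      \<open>F\<close>.\<close>
    moreover have "{x \<in> V. c \<le> x} \<subseteq> (\<lambda>\<phi>. max c (eval (chain {0..1} k) v \<phi>)) ` F"
    proof
      fix x assume x: "x \<in> {x \<in> V. c \<le> x}"
      have "x = c \<or> x = 1 \<or> x \<in> v ` X"
      proof -
        have "k q = c \<or> k q = 1" if "q \<in> K" "c \<le> k q" for q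
          using small[OF that(1)] large[OF that(1)] that(2) by force
        then show ?thesis using x c by (auto simp: V_def)
      qed
      then have "\<exists>\<xi>\<in>F. x = max c (eval (chain {0..1} k) v \<xi>)"
      proof (elim disjE)
        assume "x = c"
        then show ?thesis by (intro bexI[of _ "Const (Qunit p)"]) (simp_all add: F_def c_def)
      next
        assume "x = 1"
        then show ?thesis using c by (intro bexI[of _ One]) (simp_all add: F_def)
      next
        assume "x \<in> v ` X"
        then obtain n where "n \<in> X" "x = v n" by blast
        then show ?thesis using x by (intro bexI[of _ "Var n"]) (simp_all add: F_def)
      qed
      then show "x \<in> (\<lambda>\<phi>. max c (eval (chain {0..1} k) v \<phi>)) ` F" by blast
    qed
    ultimately have bound: "enat (card {x \<in> V. c \<le> x}) \<le> \<gamma> + 2"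
      using card_mono[of "(\<lambda>\<phi>. max c (eval (chain {0..1} k) v \<phi>)) ` F" "{x \<in> V. c \<le> x}"] \<open>finite F\<close>
      by (meson enat_ord_simps(1) finite_imageI order_trans)
    \<comment> \<open>Values up to \<open>c\<close> become rationals, with \<open>c\<close> going to
      \<open>p\<close>; monotonicity sharpens the bound 1 used here to \<open>p\<close>.\<close>
    obtain h0 where h0: "strict_mono_on {x \<in> V. x \<le> c} h0"
        "\<And>q. q \<in> {q \<in> K. val q \<le> p} \<Longrightarrow> h0 (k q) = val q"
        "h0 ` {x \<in> V. x \<le> c} \<subseteq> {0..<1} \<inter> \<rat>"
    proof (rule rational_interpolation[of "{x \<in> V. x \<le> c}" "{q \<in> K. val q \<le> p}" k 1])
      show "k p' < k q" if "p' \<in> {q \<in> K. val q \<le> p}" "q \<in> {q \<in> K. val q \<le> p}" "val p' < val q" for p' q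
        using kv(5)[of p' q] small[of q] c(1) that by auto
    qed (use V fin K0 p1 kv(3) small in \<open>auto simp: V_def\<close>)
    have h0c: "h0 c = p" using h0(2)[of "Qunit p"] Kp by (simp add: c_def)
    have h0_le: "0 \<le> h0 x" "h0 x \<le> p" "h0 x \<in> \<rat>" if "x \<in> V" "x \<le> c" for x
    proof -
      show "0 \<le> h0 x" "h0 x \<in> \<rat>" using h0(3) that by auto
      have "c \<in> V" using Kp(1) by (simp add: V_def c_def)
      then show "h0 x \<le> p"
        using strict_mono_onD[OF h0(1), of x c] that h0c by (cases "x = c") auto
    qed
    \<comment> \<open>The rank of \<open>x\<close> among the values above \<open>c\<close> selects
      its ladder point, so the order is preserved.\<close>
    define m where "m x = card {y \<in> V. c < y \<and> y < x}" for x
    have m_less: "m x < m y" if "x \<in> V" "c < x" "x < y" for x y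
      unfolding m_def using that V(1) by (intro psubset_card_mono) auto
    have m_bound: "enat (m x) < \<gamma>" if "x \<in> V" "c < x" "x < 1" for x
    proof -
      have "c \<in> V" "1 \<in> V" using Kp(1) by (simp_all add: V_def c_def)
      \<comment> \<open>Besides the values counted by \<open>m x\<close>, also \<open>c\<close>,
        \<open>x\<close> and 1 lie from \<open>c\<close> on. The bound gives
        \<open>m x + 3 \<le> \<gamma> + 2\<close>, hence \<open>m x < \<gamma>\<close>: the ladder
        is long enough.\<close>
      then have "insert c (insert x (insert 1 {y \<in> V. c < y \<and> y < x})) \<subseteq> {x \<in> V. c \<le> x}"
        using that by auto
      then have "card (insert c (insert x (insert 1 {y \<in> V. c < y \<and> y < x}))) \<le> card {x \<in> V. c \<le> x}"
        using V(1) by (intro card_mono) auto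
      moreover have "card (insert c (insert x (insert 1 {y \<in> V. c < y \<and> y < x}))) = m x + 3"
        using V(1) that by (simp add: m_def)
      ultimately have "enat (m x + 3) \<le> \<gamma> + 2" using bound
        by (cases \<gamma>) (simp_all add: numeral_eq_enat)
      then show ?thesis by (cases \<gamma>) (simp_all add: numeral_eq_enat)
    qed
    define h where "h x = (if x \<le> c then h0 x else if x = 1 then 1 else ladder p (m x))" for x
    show "\<not> admissible (add_axioms RG \<Sigma>) \<Gamma> \<phi>"
    proof (rule not_admissible_ladder[of p \<gamma> \<Sigma> V h \<phi> \<Gamma> v k])
      show "strict_mono_on V h"
      proof (rule strict_mono_onI)
        fix x y assume xy: "x \<in> V" "y \<in> V" "x < y"
        consider "y \<le> c" | "x \<le> c" "c < y" | "c < x" by linarith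
        then show "h x < h y"
        proof cases
          case 1
          then show ?thesis using xy strict_mono_onD[OF h0(1), of x y] by (simp add: h_def)
        next
          case 2
          then show ?thesis
            using h0_le(2)[OF xy(1)] p1 ladder_bounds(1)[OF p1(2), of "m y"] by (auto simp: h_def)
        next
          case 3
          then have "x < 1" using xy V(2) by force
          then show ?thesis
            using 3 xy m_less[OF xy(1) 3 xy(3)] ladder_bounds(2)[OF p1(2), of "m x"]
            by (auto simp: h_def ladder_less_iff[OF p1(2)])
        qed
      qed
      show "h ` V \<subseteq> ladder_carrier p \<gamma>"
      proof
        fix d assume "d \<in> h ` V"
        then obtain x where x: "x \<in> V" "d = h x" by auto
        then have "x \<le> 1" using V(2) by auto
        then show "d \<in> ladder_carrier p \<gamma>"
          using x h0_le[OF x(1)] m_bound[OF x(1)] by (auto simp: h_def ladder_carrier_def)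
      qed
      show "h 0 = 0" using h0(2)[of "Qunit 0"] K0 kv(3) c p1 by (simp add: h_def)
      show "h 1 = 1" using c by (simp add: h_def)
      show "k q \<in> V \<and> h (k q) = cut_const p q \<and> (p < val q \<longrightarrow> Const q \<in> \<Sigma>)"
        if "\<psi> \<in> insert \<phi> \<Gamma>" "q \<in> constants \<psi>" for \<psi> q
      proof -
        have q: "q \<in> K" using that by (auto simp: K_def)
        show ?thesis
          using q small[OF q] large[OF q] h0(2)[of q] in_\<Sigma> c
          by (cases "val q \<le> p") (auto simp: V_def h_def cut_const_def)
      qed
      show "v n \<in> V" if "\<psi> \<in> insert \<phi> \<Gamma>" "n \<in> vars \<psi>" for \<psi> n
        using that unfolding V_def X_def by blast
    qed (use p models \<Gamma> ev(1,2) in \<open>auto simp: V_def\<close>)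
  qed
qed

theorem theorem8p4:
  fixes r p :: real and \<gamma> :: enat and z :: nat
  assumes "r \<in> {0<..1}" and "p \<in> {0..<1} \<inter> \<rat>"
  shows "admissible_base (RG_lower r) {({Or (cst q) (Var z)}, Var z) | q. q \<in> {0..<r} \<inter> \<rat>} \<and>
         admissible_base (RG_upper p \<gamma>) {({Or (cst p) (Var z)}, Var z)}"
  using admissible_base_RG_lower[OF assms(1)] admissible_base_RG_upper[OF assms(2)] by blast

end
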